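(* Let $F_q$ be the finite field with $q$ elements, let $n\geq 1$, and let $F$ be an algebraically closed field of characteristic different from $2$. For every irreducible representation $\pi$ of $GL_{n+1}(F_{q})$ over $F$ we have $\dim(\pi^{GL_{n}(F_{q})})\leq 2$.
   Context: $GL_n(F_q)$ is viewed as a subgroup of $GL_{n+1}(F_q)$ via the standard embedding $B\mapsto\begin{pmatrix}B&0\\0&1\end{pmatrix}$. $\pi^{GL_n(F_q)}$ denotes the space of $GL_n(F_q)$-invariant vectors of $\pi$. *)

theory Defs
  imports
    "HOL-Algebra.Group_Action"
    "HOL-Computational_Algebra.Polynomial"
    "Jordan_Normal_Form.Matrix"
begin

definition general_linear_group :: "nat \<Rightarrow> 'q :: field mat monoid" where
  "general_linear_group n = units_of (ring_mat TYPE('q) n ())"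

lemma group_general_linear_group: "group (general_linear_group n :: 'q :: field mat monoid)"
proof -
  interpret ring "ring_mat TYPE('q) n ()" by (rule ring_mat)
  show ?thesis unfolding general_linear_group_def by (rule units_group)
qed

definition corner_embedding :: "nat \<Rightarrow> 'q :: field mat \<Rightarrow> 'q mat" where
  "corner_embedding n B = four_block_mat B (0\<^sub>m n 1) (0\<^sub>m 1 n) (1\<^sub>m 1)"

text \<open>
  The representation space is the whole type \<open>'v\<close>, with the scalar multiplication \<open>scale\<close>;
  no finiteness of the dimension is assumed.
\<close>

locale group_representation = group_action G UNIV \<rho> + vector_space scale
  for G :: "('g, 'm) monoid_scheme" (structure)
    and scale :: "'f :: field \<Rightarrow> 'v :: ab_group_add \<Rightarrow> 'v"
    and \<rho> :: "'g \<Rightarrow> 'v \<Rightarrow> 'v" +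
  assumes linear_action: "g \<in> carrier G \<Longrightarrow> Vector_Spaces.linear scale scale (\<rho> g)"

locale irreducible_representation = group_representation G scale \<rho>
  for G :: "('g, 'm) monoid_scheme" (structure)
    and scale :: "'f :: field \<Rightarrow> 'v :: ab_group_add \<Rightarrow> 'v"
    and \<rho> :: "'g \<Rightarrow> 'v \<Rightarrow> 'v" +
  assumes nonzero_space: "\<exists>v :: 'v. v \<noteq> 0"
    and irreducible:
      "\<lbrakk>subspace W; \<And>g w. g \<in> carrier G \<Longrightarrow> w \<in> W \<Longrightarrow> \<rho> g w \<in> W\<rbrakk>
        \<Longrightarrow> W = {0} \<or> W = UNIV"

definition fixed_vectors :: "'g set \<Rightarrow> ('g \<Rightarrow> 'v \<Rightarrow> 'v) \<Rightarrow> 'v set" where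
  "fixed_vectors H \<rho> = {v. \<forall>h\<in>H. \<rho> h v = v}"

end

theory Submission
  imports Defs "Jordan_Normal_Form.Determinant" "HOL-Library.Function_Algebras"
begin

text \<open>
  Write \<open>G = GL\<^sub>n\<^sub>+\<^sub>1\<close> and \<open>H = GL\<^sub>n\<close>. Every square matrix is conjugate to its transpose, so transposition
  preserves the character of \<open>\<pi>\<close>. Since an irreducible representation over an algebraically closed
  field has all endomorphisms as its group algebra image and the trace form is nondegenerate,
  transposition descends to an anti-automorphism of the endomorphism algebra, which yields a
  nondegenerate symmetric or antisymmetric form \<open>\<beta>\<close> on \<open>\<pi>\<close> with
  \<open>\<beta> (\<pi> g x) y = \<beta> x (\<pi> g\<^sup>T y)\<close>. This works in every characteristic.

  Up to the centre, there is only one pair of \<open>H\<close>-double cosets which transposition does not fix,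
  namely those of an elementary transvection and of its transpose. For \<open>H\<close>-fixed vectors \<open>x\<close> and \<open>y\<close>,
  invariance of the matrix coefficient \<open>g \<mapsto> \<beta> (\<pi> g x) y\<close> under transposition is therefore a single
  linear condition. If there were three independent fixed vectors, the condition could be met in a
  way that contradicts the independence of matrix coefficients.
\<close>

section \<open>Eigenvectors and Schur's lemma\<close>

text \<open>Relations in the group algebra are transferred through the trace form on endomorphisms
  instead. Both matrix facts are obtained from bilinear forms on coordinate space: conjugacy to the
  transpose from a form for which the matrix is self-adjoint, and the double cosets from a symmetric
  form with one or two prescribed rows. The exceptional double cosets consist of matrices for which
  exactly one of the last column and the last row vanishes off the diagonal. The contradiction comes
  from \<open>\<beta> (T x) y = \<epsilon> * \<beta> (T y) x\<close> for all operators
  \<open>T\<close>: with \<open>T x\<close> arbitrary and \<open>T y = 0\<close> it puts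
  \<open>y\<close> into the radical. For fixed \<open>x\<close> the linear condition on
  \<open>y\<close> has a nonzero solution in any plane, and a plane of fixed vectors independent of
  \<open>x\<close> takes three dimensions. In the antisymmetric case the plane is allowed to contain
  \<open>x\<close>; the vector in the radical then has a coefficient multiplied by 2, which is where
  the characteristic enters.\<close>

lemma vector_space_field: "vector_space ((*) :: 'f::field \<Rightarrow> 'f \<Rightarrow> 'f)"
  by unfold_locales (auto simp: algebra_simps)

context vector_space
begin

text \<open>The vectors are indexed because powers of an operator applied to a vector may coincide.
  A repetition is by itself a dependency, with coefficients 1 and -1.\<close>

lemma family_dependent:
  fixes f :: "nat \<Rightarrow> 'b"
  assumes "finite B" "\<And>i. i < m \<Longrightarrow> f i \<in> span B" "card B < m"
  shows "\<exists>c. (\<Sum>i<m. scale (c i) (f i)) = 0 \<and> (\<exists>i<m. c i \<noteq> 0)"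
proof (cases "inj_on f {..<m}")
  case True
  have "dependent (f ` {..<m})"
  proof (rule ccontr)
    assume "independent (f ` {..<m})"
    then have "card (f ` {..<m}) \<le> card B"
      using independent_span_bound[of B "f ` {..<m}"] assms by auto
    then show False
      using True assms(3) by (simp add: card_image)
  qed
  then obtain u where u: "\<exists>v\<in>f ` {..<m}. u v \<noteq> 0" "(\<Sum>v\<in>f ` {..<m}. scale (u v) v) = 0"
    by (auto simp: dependent_finite)
  then show ?thesis
    using True by (intro exI[of _ "u \<circ> f"]) (auto simp: sum.reindex)
next
  case False
  then obtain i j where ij: "i < m" "j < m" "i \<noteq> j" "f i = f j"
    by (auto simp: inj_on_def)
  define c :: "nat \<Rightarrow> 'a" where "c l = (if l = i then 1 else if l = j then -1 else 0)" for l
  have "(\<Sum>l<m. scale (c l) (f l)) = (\<Sum>l\<in>{i,j}. scale (c l) (f l))"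
    using ij by (intro sum.mono_neutral_right) (auto simp: c_def)
  also have "\<dots> = 0"
    using ij by (simp add: c_def)
  finally show ?thesis
    using ij by (intro exI[of _ c]) (auto simp: c_def)
qed

end

text \<open>Take a nonzero polynomial \<open>p\<close> of least degree with
  \<open>p(T) v = 0\<close> and a root \<open>x\<close> of it. Writing \<open>p = (X - x) q\<close>,
  the vector \<open>q(T) v\<close> is nonzero by minimality and is killed by
  \<open>T - x\<close>.\<close>

lemma linear_exists_eigenvector:
  fixes scale :: "'f::alg_closed_field \<Rightarrow> 'v::ab_group_add \<Rightarrow> 'v" and v :: 'v
  assumes "Vector_Spaces.linear scale scale T" "finite B" "module.span scale B = UNIV" "v \<noteq> 0"
  shows "\<exists>c w. w \<noteq> 0 \<and> T w = scale c w"
proof -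
  interpret vector_space scale
    using assms(1) by (rule Vector_Spaces.linear.axioms)
  interpret T: Vector_Spaces.linear scale scale T by fact
  define ev where "ev p = (\<Sum>i\<le>degree p. scale (coeff p i) ((T ^^ i) v))" for p :: "'f poly"
  have ev_alt: "ev p = (\<Sum>i\<le>m. scale (coeff p i) ((T ^^ i) v))" if "degree p \<le> m" for p m
    unfolding ev_def using that by (intro sum.mono_neutral_left) (auto simp: coeff_eq_0)
  let ?m = "Suc (card B)"
  obtain c where c: "(\<Sum>i<?m. scale (c i) ((T ^^ i) v)) = 0" "\<exists>i<?m. c i \<noteq> 0"
    using family_dependent[of B ?m "\<lambda>i. (T ^^ i) v"] assms by auto
  define p where "p = (\<Sum>i<?m. monom (c i) i)"
  have coeff_p: "coeff p i = (if i < ?m then c i else 0)" for i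
    by (auto simp: p_def coeff_sum sum.delta if_distrib cong: if_cong)
  have "p \<noteq> 0"
    using c(2) coeff_p by (metis coeff_0)
  moreover have "ev p = 0"
  proof -
    have "degree p \<le> card B"
      by (rule degree_le) (simp add: coeff_p)
    then show ?thesis
      using c(1) by (simp add: ev_alt coeff_p lessThan_Suc_atMost[symmetric] del: sum.lessThan_Suc)
  qed
  ultimately have ex: "\<exists>p. p \<noteq> 0 \<and> ev p = 0" by blast
  obtain p where p: "p \<noteq> 0" "ev p = 0"
    and min: "\<And>q. q \<noteq> 0 \<Longrightarrow> ev q = 0 \<Longrightarrow> degree p \<le> degree q"
    using ex_has_least_nat[of "\<lambda>p. p \<noteq> 0 \<and> ev p = 0" _ degree] ex by blast
  have "degree p > 0"
  proof (rule ccontr)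
    assume "\<not> degree p > 0"
    then have "ev p = scale (lead_coeff p) v"
      by (simp add: ev_def)
    then show False
      using p \<open>v \<noteq> 0\<close> by simp
  qed
  then obtain x where "poly p x = 0"
    using alg_closed_imp_poly_has_root by blast
  then obtain q where q: "p = [:-x, 1:] * q"
    by (auto simp: poly_eq_0_iff_dvd)
  have "q \<noteq> 0"
    using p q by auto
  then have deg: "degree p = Suc (degree q)"
    unfolding q by (subst degree_mult_eq) auto
  have "ev q \<noteq> 0"
    using min[of q] \<open>q \<noteq> 0\<close> deg by auto
  have cf: "coeff p i = (case i of 0 \<Rightarrow> 0 | Suc j \<Rightarrow> coeff q j) - x * coeff q i" for i
    by (simp add: q coeff_pCons split: nat.split)
  have "ev p = (\<Sum>i\<le>Suc (degree q). scale (case i of 0 \<Rightarrow> 0 | Suc j \<Rightarrow> coeff q j) ((T ^^ i) v))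
      - (\<Sum>i\<le>Suc (degree q). scale x (scale (coeff q i) ((T ^^ i) v)))"
    by (simp only: ev_def deg cf sum_subtractf scale_left_diff_distrib scale_scale)
  also have "(\<Sum>i\<le>Suc (degree q). scale (case i of 0 \<Rightarrow> 0 | Suc j \<Rightarrow> coeff q j) ((T ^^ i) v))
      = T (ev q)"
    by (subst sum.atMost_Suc_shift) (simp add: ev_def T.sum T.scale)
  also have "(\<Sum>i\<le>Suc (degree q). scale x (scale (coeff q i) ((T ^^ i) v))) = scale x (ev q)"
    by (subst ev_alt[of q "Suc (degree q)"]) (simp_all only: scale_sum_right le_SucI order_refl)
  finally have "T (ev q) = scale x (ev q)"
    using p by simp
  then show ?thesis
    using \<open>ev q \<noteq> 0\<close> by blast
qed

locale finite_irrep = irreducible_representation G scale \<rho>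
  for G :: "('g, 'm) monoid_scheme" (structure)
    and scale :: "'f :: alg_closed_field \<Rightarrow> 'v :: ab_group_add \<Rightarrow> 'v"
    and \<rho> :: "'g \<Rightarrow> 'v \<Rightarrow> 'v" +
  assumes finite_group: "finite (carrier G)"
begin

sublocale group G
  using group_hom group_hom.axioms(1) by auto

lemma act_mult: "g \<in> carrier G \<Longrightarrow> h \<in> carrier G \<Longrightarrow> \<rho> (g \<otimes> h) v = \<rho> g (\<rho> h v)"
  by (rule composition_rule) auto

lemma act_one [simp]: "\<rho> \<one> v = v"
  using id_eq_one by (metis UNIV_I restrict_apply')

lemma act_add: "g \<in> carrier G \<Longrightarrow> \<rho> g (v + w) = \<rho> g v + \<rho> g w"
  and act_scale: "g \<in> carrier G \<Longrightarrow> \<rho> g (scale c v) = scale c (\<rho> g v)"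
  using linear_action[of g] by (auto simp: Vector_Spaces.linear_iff)

lemma act_zero: "g \<in> carrier G \<Longrightarrow> \<rho> g 0 = 0"
  using act_add[of g 0 0] by simp

text \<open>The orbit of a nonzero vector is finite and its span is invariant, so by irreducibility
  it spans everything.\<close>

lemma finite_dimensional: "\<exists>B. finite B \<and> span B = UNIV"
proof -
  obtain v :: 'v where v: "v \<noteq> 0" using nonzero_space by blast
  let ?B = "(\<lambda>g. \<rho> g v) ` carrier G"
  have "\<rho> g w \<in> span ?B" if g: "g \<in> carrier G" and w: "w \<in> span ?B" for g w
    using w
  proof (induction rule: span_induct_alt)
    case base
    then show ?case using g by (simp add: act_zero span_zero)
  next
    case (step c x y)
    then obtain h where "h \<in> carrier G" "x = \<rho> h v" by auto
    then have "\<rho> g x \<in> span ?B"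
      using g by (auto simp: act_mult[symmetric] intro!: span_base)
    then show ?case
      using step g by (auto simp: act_add act_scale intro!: span_add span_scale)
  qed
  then have "span ?B = {0} \<or> span ?B = UNIV"
    by (intro irreducible) (auto simp: subspace_span)
  moreover have "\<rho> \<one> v \<in> span ?B"
    by (intro span_base imageI one_closed)
  ultimately show ?thesis
    using v finite_group by (intro exI[of _ ?B]) auto
qed

text \<open>A basis is chosen once and for all because the locale of finite-dimensional spaces takes
  it as a parameter.\<close>

definition basis :: "'v set" where
  "basis = (SOME B. finite B \<and> independent B \<and> span B = UNIV)"

lemma basis: "finite basis" "independent basis" "span basis = UNIV"
proof -
  obtain C where C: "finite C" "span C = UNIV"
    using finite_dimensional by blast
  obtain B where B: "independent B" "UNIV \<subseteq> span B"
    using maximal_independent_subset[of UNIV] by auto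
  then have "finite B"
    using independent_span_bound[of C B] C by auto
  with B have "\<exists>B. finite B \<and> independent B \<and> span B = UNIV" by auto
  from someI_ex[OF this] show "finite basis" "independent basis" "span basis = UNIV"
    unfolding basis_def by auto
qed

sublocale finite_dimensional_vector_space scale basis
  by unfold_locales (use basis in auto)

text \<open>\<open>T\<close> has an eigenvector by finite dimension, and its eigenspace is invariant
  because \<open>T\<close> commutes with the action.\<close>

lemma Schur:
  assumes "Vector_Spaces.linear scale scale T"
    and comm: "\<And>g v. g \<in> carrier G \<Longrightarrow> T (\<rho> g v) = \<rho> g (T v)"
  shows "\<exists>c. \<forall>v. T v = scale c v"
proof -
  interpret T: Vector_Spaces.linear scale scale T by fact
  obtain v :: 'v where v: "v \<noteq> 0" using nonzero_space by blast
  obtain c w where cw: "w \<noteq> 0" "T w = scale c w"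
    using linear_exists_eigenvector[OF assms(1) _ _ v] finite_dimensional by metis
  have "{w. T w = scale c w} = {0} \<or> {w. T w = scale c w} = UNIV"
    by (rule irreducible) (auto simp: subspace_def T.add T.scale comm act_scale
        scale_right_distrib scale_left_commute)
  then show ?thesis
    using cw by auto
qed

end

section \<open>Density, traces and contravariant forms\<close>

context finite_dimensional_vector_space
begin

abbreviation coord :: "'b \<Rightarrow> 'b \<Rightarrow> 'a" where
  "coord \<equiv> representation Basis"

definition trace :: "('b \<Rightarrow> 'b) \<Rightarrow> 'a" where
  "trace T = (\<Sum>b\<in>Basis. coord (T b) b)"

lemma coord_add: "coord (v + w) b = coord v b + coord w b"
  and coord_scale: "coord (scale c v) b = c * coord v b"
  and coord_sum: "coord (sum f A) b = (\<Sum>i\<in>A. coord (f i) b)"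
  and coord_zero [simp]: "coord 0 b = 0"
  and coord_Basis: "a \<in> Basis \<Longrightarrow> coord a b = (if b = a then 1 else 0)"
  and sum_coord: "(\<Sum>b\<in>Basis. scale (coord v b) b) = v"
  by (simp_all add: representation_add representation_scale representation_sum
      representation_zero representation_basis sum_representation_eq
      independent_Basis span_Basis finite_Basis)

lemma coord_ne_zero:
  assumes "v \<noteq> 0"
  shows "\<exists>b\<in>Basis. coord v b \<noteq> 0"
proof (rule ccontr)
  assume "\<not> ?thesis"
  then have "(\<Sum>b\<in>Basis. scale (coord v b) b) = 0" by simp
  then show False using assms by (simp add: sum_coord)
qed

lemma trace_zero: "trace (\<lambda>_. 0) = 0"
  and trace_add_scale: "trace (\<lambda>v. T v + scale c (U v)) = trace T + c * trace U"
  by (simp_all add: trace_def coord_add coord_scale sum.distrib sum_distrib_left)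

lemma coord_linear_comp:
  assumes "Vector_Spaces.linear scale scale T"
  shows "coord (T v) a = (\<Sum>c\<in>Basis. coord v c * coord (T c) a)"
proof -
  interpret T: Vector_Spaces.linear scale scale T by fact
  have "T v = (\<Sum>c\<in>Basis. scale (coord v c) (T c))"
    by (subst (1) sum_coord[of v, symmetric]) (simp add: T.sum T.scale)
  then show ?thesis by (simp add: coord_sum coord_scale)
qed

lemma trace_comp_commute:
  assumes "Vector_Spaces.linear scale scale T" "Vector_Spaces.linear scale scale U"
  shows "trace (T \<circ> U) = trace (U \<circ> T)"
proof -
  have "trace (T \<circ> U) = (\<Sum>b\<in>Basis. \<Sum>c\<in>Basis. coord (U b) c * coord (T c) b)"
    by (simp add: trace_def coord_linear_comp[OF assms(1), of "U _"])
  also have "\<dots> = (\<Sum>b\<in>Basis. \<Sum>c\<in>Basis. coord (T b) c * coord (U c) b)"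
    by (subst sum.swap) (simp add: mult.commute)
  also have "\<dots> = trace (U \<circ> T)"
    by (simp add: trace_def coord_linear_comp[OF assms(2), of "T _"])
  finally show ?thesis .
qed

text \<open>Nondegeneracy of the trace form: composing \<open>T\<close> with a rank-one operator and
  taking the trace recovers any chosen matrix entry of \<open>T\<close>.\<close>

lemma trace_rank_one:
  assumes "Vector_Spaces.linear scale scale T" "b \<in> Basis"
  shows "trace (\<lambda>v. scale (coord (T v) c) b) = coord (T b) c"
proof -
  have "trace (\<lambda>v. scale (coord (T v) c) b) = (\<Sum>a\<in>Basis. if a = b then coord (T b) c else 0)"
    unfolding trace_def using assms(2)
    by (intro sum.cong) (auto simp: coord_scale coord_Basis)
  then show ?thesis using assms(2) by (simp add: finite_Basis)
qed

end

section \<open>The group algebra with an anti-involution that preserves conjugacy classes\<close>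

locale finite_irrep_inv = finite_irrep G scale \<rho>
  for G :: "('g, 'm) monoid_scheme" (structure)
    and scale :: "'f :: alg_closed_field \<Rightarrow> 'v :: ab_group_add \<Rightarrow> 'v"
    and \<rho> :: "'g \<Rightarrow> 'v \<Rightarrow> 'v" +
  fixes \<sigma> :: "'g \<Rightarrow> 'g"
  assumes sigma_closed [simp]: "g \<in> carrier G \<Longrightarrow> \<sigma> g \<in> carrier G"
    and sigma_mult: "\<lbrakk>g \<in> carrier G; h \<in> carrier G\<rbrakk> \<Longrightarrow> \<sigma> (g \<otimes> h) = \<sigma> h \<otimes> \<sigma> g"
    and sigma_sigma [simp]: "g \<in> carrier G \<Longrightarrow> \<sigma> (\<sigma> g) = g"
    and sigma_conj: "g \<in> carrier G \<Longrightarrow> \<exists>s\<in>carrier G. \<sigma> g = s \<otimes> g \<otimes> inv s"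
begin

text \<open>\<open>adj T T'\<close> holds iff for some coefficients \<open>a\<close>, \<open>T\<close> is the operator \<open>\<Sum>g. a g \<cdot> \<rho> g\<close>
  and \<open>T'\<close> the operator \<open>\<Sum>g. a g \<cdot> \<rho> (\<sigma> g)\<close>.\<close>

inductive adj :: "('v \<Rightarrow> 'v) \<Rightarrow> ('v \<Rightarrow> 'v) \<Rightarrow> bool" where
  adj_zero: "adj (\<lambda>_. 0) (\<lambda>_. 0)"
| adj_step: "\<lbrakk>adj T T'; g \<in> carrier G\<rbrakk>
    \<Longrightarrow> adj (\<lambda>v. T v + scale c (\<rho> g v)) (\<lambda>v. T' v + scale c (\<rho> (\<sigma> g) v))"

lemma adj_linear:
  assumes "adj T T'"
  shows "Vector_Spaces.linear scale scale T" "Vector_Spaces.linear scale scale T'"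
  using assms
  by (induction) (auto simp: Vector_Spaces.linear_iff vector_space_axioms act_add act_scale algebra_simps
      scale_right_distrib scale_left_commute)

lemma adj_sym: "adj T T' \<Longrightarrow> adj T' T"
proof (induction rule: adj.induct)
  case (adj_step T T' g c)
  then show ?case using adj.adj_step[of T' T "\<sigma> g" c] by simp
qed (rule adj_zero)

lemma adj_act: "g \<in> carrier G \<Longrightarrow> adj (\<rho> g) (\<rho> (\<sigma> g))"
  using adj_step[OF adj_zero, of g 1] by simp

lemma adj_ident: "adj (\<lambda>v. v) (\<lambda>v. v)"
proof -
  have "\<sigma> \<one> = \<one>"
    using sigma_mult[of "\<sigma> \<one>" \<one>] by simp
  moreover have "\<rho> \<one> = (\<lambda>v. v)"
    by (rule ext) simp
  ultimately show ?thesis using adj_act[OF one_closed] by metis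
qed

lemma adj_add:
  assumes "adj T T'" "adj U U'"
  shows "adj (\<lambda>v. T v + U v) (\<lambda>v. T' v + U' v)"
  using assms(2)
proof (induction)
  case adj_zero
  then show ?case using assms(1) by simp
next
  case (adj_step U U' g c)
  then show ?case
    using adj.adj_step[OF adj_step.IH, of g c] by (simp add: add.assoc)
qed

lemma adj_scale: "adj T T' \<Longrightarrow> adj (\<lambda>v. scale c (T v)) (\<lambda>v. scale c (T' v))"
proof (induction rule: adj.induct)
  case adj_zero
  then show ?case using adj.adj_zero by simp
next
  case (adj_step T T' g d)
  then show ?case
    using adj.adj_step[OF adj_step.IH, of g "c * d"] by (simp add: scale_right_distrib)
qed

lemma adj_diff:
  "adj T T' \<Longrightarrow> adj U U' \<Longrightarrow> adj (\<lambda>v. T v - U v) (\<lambda>v. T' v - U' v)"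
  using adj_add[of T T' "\<lambda>v. scale (-1) (U v)" "\<lambda>v. scale (-1) (U' v)"] adj_scale[of U U' "-1"]
  by simp

lemma adj_act_comp:
  assumes "adj T T'" "g \<in> carrier G"
  shows "adj (\<lambda>v. \<rho> g (T v)) (\<lambda>v. T' (\<rho> (\<sigma> g) v))"
  using assms(1)
proof (induction)
  case adj_zero
  then show ?case using adj.adj_zero assms(2) by (simp add: act_zero)
next
  case (adj_step T T' h c)
  then show ?case
    using adj.adj_step[OF adj_step.IH, of "g \<otimes> h" c] assms(2)
    by (simp add: act_add act_scale act_mult sigma_mult)
qed

lemma adj_comp:
  assumes "adj T T'" "adj U U'"
  shows "adj (\<lambda>v. T (U v)) (\<lambda>v. U' (T' v))"
  using assms(1)
proof (induction)
  case adj_zero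
  interpret U': Vector_Spaces.linear scale scale U'
    using adj_linear(2)[OF assms(2)] .
  show ?case using adj.adj_zero by (simp add: U'.zero)
next
  case (adj_step T T' g c)
  interpret U': Vector_Spaces.linear scale scale U'
    using adj_linear(2)[OF assms(2)] .
  show ?case
    using adj_add[OF adj_step.IH adj_scale[OF adj_act_comp[OF assms(2) adj_step.hyps(2)], of c]]
    by (simp add: U'.add U'.scale)
qed

text \<open>A vector \<open>x\<close> killed by all operators that kill the independent set \<open>S\<close> would, by Schur's
  lemma applied to the maps sending \<open>T s\<close> to \<open>T x\<close>, be a linear combination of \<open>S\<close>.\<close>

lemma density:
  assumes "finite S" "independent S"
  shows "\<exists>T T'. adj T T' \<and> (\<forall>s\<in>S. T s = y s)"
  using assms
proof (induction S arbitrary: y rule: finite_induct)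
  case empty
  then show ?case using adj_zero by blast
next
  case (insert x S)
  have indS: "independent S"
    using insert.prems by (rule independent_mono) auto
  have IH: "\<exists>T T'. adj T T' \<and> (\<forall>s\<in>S. T s = y s)" for y
    by (rule insert.IH[OF indS])
  have "\<exists>T T'. adj T T' \<and> (\<forall>s\<in>S. T s = 0) \<and> T x \<noteq> 0"
  proof (rule ccontr)
    assume "\<not> ?thesis"
    then have kill: "T x = 0" if "adj T T'" "\<And>s. s \<in> S \<Longrightarrow> T s = 0" for T T'
      using that by blast
    \<comment> \<open>By \<open>kill\<close>, any two operators satisfying \<open>P s v\<close>
      agree at \<open>x\<close>. Hence \<open>E s\<close> does not depend on the choice made in it,
      which makes it linear and equivariant.\<close>
    define P where "P s v T \<longleftrightarrow> (\<exists>T'. adj T T') \<and> (\<forall>r\<in>S. T r = (if r = s then v else 0))" for s v T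
    define E where "E s v = (SOME T. P s v T) x" for s v
    have P_ex: "\<exists>T. P s v T" for s v
      using IH[of "\<lambda>r. if r = s then v else 0"] by (auto simp: P_def)
    have P_E: "T x = E s v" if "P s v T" for s v T
    proof -
      have "P s v (SOME T. P s v T)"
        using P_ex by (rule someI_ex)
      then obtain U U' where U: "adj U U'" "\<forall>r\<in>S. U r = (if r = s then v else 0)"
        and "U = (SOME T. P s v T)"
        by (auto simp: P_def)
      then have E: "E s v = U x" by (simp add: E_def)
      obtain T' where "adj T T'"
        using \<open>P s v T\<close> by (auto simp: P_def)
      then have "T x - U x = 0"
        using U that by (intro kill[OF adj_diff[OF _ U(1)]]) (auto simp: P_def)
      then show ?thesis using E by simp
    qed
    have "\<exists>c. \<forall>v. E s v = scale c v" for s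
    proof (rule Schur)
      show "Vector_Spaces.linear scale scale (E s)"
        unfolding Vector_Spaces.linear_iff
      proof (intro conjI allI)
        fix v w c
        obtain T U where T: "P s v T" and U: "P s w U" using P_ex by metis
        obtain T' U' where "adj T T'" "adj U U'"
          using T U unfolding P_def by auto
        then have "P s (v + w) (\<lambda>z. T z + U z)" "P s (scale c v) (\<lambda>z. scale c (T z))"
          using T U adj_add[of T T' U U'] adj_scale[of T T' c] unfolding P_def by auto
        then show "E s (v + w) = E s v + E s w" "E s (scale c v) = scale c (E s v)"
          using P_E T U by metis+
      qed (rule vector_space_axioms)+
    next
      fix g v assume g: "g \<in> carrier G"
      obtain T where T: "P s v T" using P_ex by metis
      then have "P s (\<rho> g v) (\<lambda>z. \<rho> g (T z))"
        using adj_act_comp[OF _ g] g unfolding P_def by (auto simp: act_zero)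
      then show "E s (\<rho> g v) = \<rho> g (E s v)"
        using P_E T by metis
    qed
    then obtain c where c: "E s v = scale (c s) v" for s v by metis
    have "\<forall>s. \<exists>T. P s s T"
      using P_ex by blast
    then obtain T where T: "P s s (T s)" for s
      by metis
    then have "\<forall>s. \<exists>T'. adj (T s) T'"
      unfolding P_def by blast
    then obtain T' where T': "adj (T s) (T' s)" for s
      by metis
    have sum_op: "adj (\<lambda>v. \<Sum>s\<in>F. T s v) (\<lambda>v. \<Sum>s\<in>F. T' s v)" if "finite F" for F
      using that
    proof induction
      case empty
      then show ?case using adj_zero by simp
    next
      case (insert s F)
      then show ?case using adj_add[OF T' insert.IH, of s] by simp
    qed
    \<comment> \<open>On \<open>S\<close> the sum of the operators \<open>T s\<close> is the
      identity, so the identity minus this sum kills \<open>S\<close> and therefore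
      \<open>x\<close>.\<close>
    have "x - (\<Sum>s\<in>S. T s x) = 0"
    proof (rule kill[OF adj_diff[OF adj_ident sum_op]])
      fix r assume r: "r \<in> S"
      have "(\<Sum>s\<in>S. T s r) = (\<Sum>s\<in>S. if r = s then s else 0)"
        using T r by (intro sum.cong) (auto simp: P_def)
      then show "r - (\<Sum>s\<in>S. T s r) = 0"
        using r insert.hyps by simp
    qed (rule insert.hyps)
    then have "x = (\<Sum>s\<in>S. scale (c s) s)"
      using P_E[OF T] c by simp
    also have "\<dots> \<in> span S"
      by (intro span_sum span_scale span_base)
    finally show False
      using insert.prems insert.hyps by (simp add: independent_insert)
  qed
  then obtain T T' where T: "adj T T'" "\<And>s. s \<in> S \<Longrightarrow> T s = 0" "T x \<noteq> 0"
    by blast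
  \<comment> \<open>The images of \<open>T x\<close> form a nonzero invariant subspace, hence
    everything. So the value at \<open>x\<close> can be corrected by some \<open>R (T x)\<close>
    without changing the values on \<open>S\<close>, where \<open>T\<close> vanishes.\<close>
  define Z where "Z = {U (T x) |U U'. adj U U'}"
  have "Z = {0} \<or> Z = UNIV"
  proof (rule irreducible)
    show "subspace Z"
      unfolding subspace_def
    proof (intro conjI ballI allI)
      show "0 \<in> Z"
        unfolding Z_def using adj_zero by auto
    next
      fix v w assume "v \<in> Z" "w \<in> Z"
      then obtain U U' R R' where "adj U U'" "adj R R'" "v = U (T x)" "w = R (T x)"
        unfolding Z_def by auto
      then show "v + w \<in> Z"
        unfolding Z_def using adj_add[of U U' R R'] by auto
    next
      fix c v assume "v \<in> Z"
      then obtain U U' where "adj U U'" "v = U (T x)"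
        unfolding Z_def by auto
      then show "scale c v \<in> Z"
        unfolding Z_def using adj_scale[of U U' c] by auto
    qed
    show "\<rho> g w \<in> Z" if g: "g \<in> carrier G" and w: "w \<in> Z" for g w
    proof -
      obtain U U' where "adj U U'" "w = U (T x)"
        using w unfolding Z_def by blast
      then show ?thesis
        unfolding Z_def using adj_act_comp[of U U' g] g by auto
    qed
  qed
  moreover have "T x \<in> Z"
    using adj_ident unfolding Z_def by auto
  ultimately have Z: "Z = UNIV"
    using T(3) by auto
  obtain U U' where U: "adj U U'" "\<forall>s\<in>S. U s = y s"
    using IH by blast
  have "y x - U x \<in> Z" by (simp add: Z)
  then obtain R R' where R: "adj R R'" "R (T x) = y x - U x"
    unfolding Z_def by force
  interpret R: Vector_Spaces.linear scale scale R
    using adj_linear(1)[OF R(1)] .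
  have "\<forall>s\<in>insert x S. U s + R (T s) = y s"
    using U R T by (auto simp: R.zero)
  then show ?case
    using adj_add[OF U(1) adj_comp[OF R(1) T(1)]] by blast
qed


text \<open>Burnside's theorem: \<open>density\<close> applied to a basis realises every
  endomorphism by the group algebra.\<close>

lemma adj_total:
  assumes "Vector_Spaces.linear scale scale T"
  shows "\<exists>T'. adj T T'"
proof -
  obtain U U' where U: "adj U U'" "\<forall>b\<in>basis. U b = T b"
    using density[OF finite_Basis independent_Basis] by blast
  have "U v = T v" for v
  proof (rule vector_space_pair.linear_eq_on[OF _ adj_linear(1)[OF U(1)] assms])
    show "vector_space_pair scale scale"
      by (simp add: vector_space_pair_def vector_space_axioms)
  qed (use U span_Basis in auto)
  then have "U = T" by auto
  then show ?thesis using U by auto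
qed

text \<open>\<open>\<sigma> g\<close> is conjugate to \<open>g\<close>, so the character takes the
  same value at both; the general case follows by linearity.\<close>

lemma trace_adj:
  assumes "adj T T'"
  shows "trace T = trace T'"
  using assms
proof induction
  case (adj_step T T' g c)
  obtain s where s: "s \<in> carrier G" "\<sigma> g = s \<otimes> g \<otimes> inv s"
    using sigma_conj adj_step.hyps by blast
  have "\<rho> (\<sigma> g) = \<rho> s \<circ> (\<rho> g \<circ> \<rho> (inv s))"
    using s adj_step.hyps by (auto simp: act_mult)
  moreover have "(\<rho> g \<circ> \<rho> (inv s)) \<circ> \<rho> s = \<rho> g"
  proof
    fix v
    show "((\<rho> g \<circ> \<rho> (inv s)) \<circ> \<rho> s) v = \<rho> g v"
      using s adj_step.hyps act_mult[of "inv s" s v] by simp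
  qed
  moreover have "trace (\<rho> s \<circ> (\<rho> g \<circ> \<rho> (inv s))) = trace ((\<rho> g \<circ> \<rho> (inv s)) \<circ> \<rho> s)"
    using s adj_step.hyps
    by (intro trace_comp_commute linear_action
        Vector_Spaces.linear_compose[OF linear_action linear_action]) auto
  ultimately have "trace (\<rho> (\<sigma> g)) = trace (\<rho> g)" by simp
  then show ?case using adj_step.IH by (simp add: trace_add_scale)
qed simp

text \<open>If \<open>\<Sum>g. a g \<cdot> \<rho> g\<close> vanishes then \<open>\<Sum>g. a g \<cdot> \<rho> (\<sigma> g)\<close> is orthogonal to all operators
  for the trace form, because \<open>\<sigma>\<close> preserves the character.\<close>

lemma adj_of_zero:
  assumes "adj (\<lambda>_. 0) T'"
  shows "T' v = 0"
proof -
  have lin: "Vector_Spaces.linear scale scale T'"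
    using adj_linear[OF assms] by blast
  have Basis0: "T' b = 0" if b: "b \<in> basis" for b
  proof (rule ccontr)
    assume "T' b \<noteq> 0"
    then obtain c where c: "c \<in> basis" "coord (T' b) c \<noteq> 0"
      using coord_ne_zero by blast
    \<comment> \<open>\<open>U\<close> is chosen so that the trace of \<open>U\<close> after
      \<open>T'\<close> is the entry \<open>coord (T' b) c\<close>. As \<open>U\<close> is itself
      the adjoint of some \<open>U0\<close>, this composite is the adjoint of zero after
      \<open>U0\<close> and has trace zero.\<close>
    define U where "U v = scale (coord v c) b" for v
    have "Vector_Spaces.linear scale scale U"
      by (auto simp: U_def Vector_Spaces.linear_iff vector_space_axioms coord_add coord_scale
          scale_left_distrib)
    then obtain U0 where "adj U U0"
      using adj_total by blast
    then have "adj (\<lambda>_. 0) (\<lambda>v. U (T' v))"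
      using adj_comp[OF assms adj_sym] by simp
    then have "trace (\<lambda>v. U (T' v)) = 0"
      using trace_adj trace_zero by metis
    then show False
      using trace_rank_one[OF lin b] c(2) by (simp add: U_def)
  qed
  interpret T': Vector_Spaces.linear scale scale T' by fact
  have "T' v = (\<Sum>b\<in>basis. scale (coord v b) (T' b))"
    by (subst (1) sum_coord[of v, symmetric]) (simp add: T'.sum T'.scale)
  then show ?thesis
    using Basis0 by simp
qed

text \<open>Different coefficients may yield the same operator, so only here does the relation
  \<open>adj\<close> turn out to be a function of its first argument.\<close>

lemma adj_unique: "adj T T' \<Longrightarrow> adj T T'' \<Longrightarrow> T' v = T'' v"
  using adj_of_zero[of "\<lambda>v. T' v - T'' v" v] adj_diff[of T T' T T''] by simp

section \<open>Bilinear forms for which \<open>\<sigma> g\<close> is adjoint to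
  \<open>g\<close>\<close>

definition contravariant_form :: "('v \<Rightarrow> 'v \<Rightarrow> 'f) \<Rightarrow> bool" where
  "contravariant_form \<beta> \<longleftrightarrow>
    (\<forall>x x' y. \<beta> (x + x') y = \<beta> x y + \<beta> x' y) \<and> (\<forall>c x y. \<beta> (scale c x) y = c * \<beta> x y) \<and>
    (\<forall>x y y'. \<beta> x (y + y') = \<beta> x y + \<beta> x y') \<and> (\<forall>c x y. \<beta> x (scale c y) = c * \<beta> x y) \<and>
    (\<forall>g\<in>carrier G. \<forall>x y. \<beta> (\<rho> g x) y = \<beta> x (\<rho> (\<sigma> g) y))"

lemma contravariant_formD:
  assumes "contravariant_form \<beta>"
  shows "\<beta> (x + x') y = \<beta> x y + \<beta> x' y" "\<beta> (scale c x) y = c * \<beta> x y"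
    "\<beta> x (y + y') = \<beta> x y + \<beta> x y'" "\<beta> x (scale c y) = c * \<beta> x y"
    "g \<in> carrier G \<Longrightarrow> \<beta> (\<rho> g x) y = \<beta> x (\<rho> (\<sigma> g) y)"
  using assms by (auto simp: contravariant_form_def)

lemma contravariant_form_zero:
  assumes "contravariant_form \<beta>"
  shows "\<beta> 0 y = 0" "\<beta> x 0 = 0"
  using contravariant_formD(2)[OF assms, of 0 0 y] contravariant_formD(4)[OF assms, of x 0 0]
  by simp_all

text \<open>The rank-one operators \<open>P y\<close> with a fixed functional form a left ideal
  isomorphic to the representation, since \<open>P (\<rho> g y)\<close> is \<open>\<rho> g\<close>
  after \<open>P y\<close>. The anti-automorphism turns this into
  \<open>Q (\<rho> g y) x = Q y (\<rho> (\<sigma> g) x)\<close>, and a coordinate of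
  \<open>Q y x\<close> is the form. It is nonzero for a suitable coordinate because
  \<open>Q b = 0\<close> would force \<open>P b = 0\<close>, whereas \<open>P b\<close> fixes
  \<open>b\<close>.\<close>

lemma exists_contravariant_form: "\<exists>\<beta>. contravariant_form \<beta> \<and> (\<exists>x y. \<beta> x y \<noteq> 0)"
proof -
  obtain v :: 'v where "v \<noteq> 0" using nonzero_space by blast
  then obtain b where b: "b \<in> basis" using coord_ne_zero by blast
  then have "b \<noteq> 0" using independent_Basis dependent_zero by blast
  define P where "P y v = scale (coord v b) y" for y v
  have "Vector_Spaces.linear scale scale (P y)" for y
    by (auto simp: P_def Vector_Spaces.linear_iff vector_space_axioms coord_add coord_scale
        scale_left_distrib)
  then have "\<forall>y. \<exists>Q. adj (P y) Q"
    using adj_total by blast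
  then obtain Q where Q: "adj (P y) (Q y)" for y by metis
  have Q_eq: "R v = Q y v" if "adj (P y) R" for y R v
    using that Q by (rule adj_unique)
  have Q_linear: "Q y (v + w) = Q y v + Q y w" "Q y (scale c v) = scale c (Q y v)" for y v w c
    using adj_linear(2)[OF Q] by (auto simp: Vector_Spaces.linear_iff)
  have Q_add: "Q (y + z) v = Q y v + Q z v" for y z v
  proof -
    have "P (y + z) = (\<lambda>v. P y v + P z v)"
      by (auto simp: P_def scale_right_distrib)
    then show ?thesis
      using Q_eq[of "y + z" "\<lambda>v. Q y v + Q z v" v] adj_add[OF Q Q, of y z] by simp
  qed
  have Q_scale: "Q (scale c y) v = scale c (Q y v)" for c y v
  proof -
    have "P (scale c y) = (\<lambda>v. scale c (P y v))"
      by (auto simp: P_def scale_left_commute)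
    then show ?thesis
      using Q_eq[of "scale c y" "\<lambda>v. scale c (Q y v)" v] adj_scale[OF Q, of c y] by simp
  qed
  have Q_act: "Q (\<rho> g y) v = Q y (\<rho> (\<sigma> g) v)" if g: "g \<in> carrier G" for g y v
  proof -
    have "P (\<rho> g y) = (\<lambda>v. \<rho> g (P y v))"
      using g by (auto simp: P_def act_scale)
    then show ?thesis
      using Q_eq[of "\<rho> g y" "\<lambda>v. Q y (\<rho> (\<sigma> g) v)" v] adj_act_comp[OF Q g, of y] by simp
  qed
  have "\<exists>x. Q b x \<noteq> 0"
  proof (rule ccontr)
    assume "\<not> ?thesis"
    then have "Q b = (\<lambda>_. 0)" by auto
    then have "P b b = 0"
      using adj_sym[OF Q[of b]] by (intro adj_of_zero) simp
    then show False
      using b \<open>b \<noteq> 0\<close> by (simp add: P_def coord_Basis)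
  qed
  then obtain x c where x: "coord (Q b x) c \<noteq> 0"
    using coord_ne_zero by blast
  have "contravariant_form (\<lambda>x y. coord (Q y x) c)"
    by (auto simp: contravariant_form_def Q_linear Q_add Q_scale Q_act coord_add coord_scale)
  then show ?thesis using x by blast
qed

text \<open>Exchanging the arguments preserves contravariance because \<open>\<sigma>\<close> is an
  involution, so a form can be symmetrised. If the result vanishes, the form was antisymmetric from
  the start.\<close>

lemma exists_symmetric_contravariant_form:
  "\<exists>\<beta> \<epsilon>. contravariant_form \<beta> \<and> (\<exists>x y. \<beta> x y \<noteq> 0) \<and> (\<epsilon> = 1 \<or> \<epsilon> = -1) \<and> (\<forall>x y. \<beta> x y = \<epsilon> * \<beta> y x)"
proof -
  obtain \<beta> where \<beta>: "contravariant_form \<beta>" "\<exists>x y. \<beta> x y \<noteq> 0"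
    using exists_contravariant_form by blast
  define \<gamma> where "\<gamma> x y = \<beta> x y + \<beta> y x" for x y
  show ?thesis
  proof (cases "\<exists>x y. \<gamma> x y \<noteq> 0")
    case True
    have "\<beta> y (\<rho> g x) = \<beta> (\<rho> (\<sigma> g) y) x" if "g \<in> carrier G" for g x y
      using contravariant_formD(5)[OF \<beta>(1), of "\<sigma> g" y x] that by simp
    then have "contravariant_form \<gamma>"
      using contravariant_formD[OF \<beta>(1)]
      by (auto simp: contravariant_form_def \<gamma>_def algebra_simps)
    then show ?thesis
      using True by (intro exI[of _ \<gamma>] exI[of _ 1]) (auto simp: \<gamma>_def add.commute)
  next
    case False
    then have "\<beta> x y = -1 * \<beta> y x" for x y
      by (auto simp: \<gamma>_def eq_neg_iff_add_eq_0)
    then show ?thesis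
      using \<beta> by blast
  qed
qed

text \<open>The right radical is an invariant subspace, and it is not the whole space.\<close>

lemma contravariant_form_nondegenerate:
  assumes "contravariant_form \<beta>" "\<beta> x0 y0 \<noteq> 0" "\<And>x. \<beta> x y = 0"
  shows "y = 0"
proof -
  note \<beta> = contravariant_formD[OF assms(1)]
  have "\<beta> x (\<rho> g z) = \<beta> (\<rho> (\<sigma> g) x) z" if "g \<in> carrier G" for g x z
    using \<beta>(5)[of "\<sigma> g" x z] that by simp
  with \<beta>(1-4) have "{y. \<forall>x. \<beta> x y = 0} = {0} \<or> {y. \<forall>x. \<beta> x y = 0} = UNIV"
    by (intro irreducible) (auto simp: subspace_def contravariant_form_zero[OF assms(1)])
  then show ?thesis
    using assms(2,3) by blast
qed

end

section \<open>A criterion for fixed spaces of dimension at most two\<close>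

context finite_irrep_inv
begin

text \<open>The coset condition says that a function \<open>f\<close> which is bi-invariant under \<open>H\<close> and on which
  \<open>Z\<close> acts by a character satisfies \<open>f \<circ> \<sigma> = f\<close> as soon as \<open>f (\<sigma> g0) = f g0\<close>. For a pair of
  fixed vectors \<open>x\<close>, \<open>y\<close> this is a single linear condition on the matrix coefficient
  \<open>g \<mapsto> \<beta> (\<rho> g x) y\<close>; three independent fixed vectors leave enough room to satisfy it.\<close>

lemma matrix_coefficient_symmetric:
  assumes "H \<subseteq> carrier G" "\<And>h. h \<in> H \<Longrightarrow> \<sigma> h \<in> H"
    and "Z \<subseteq> carrier G" "\<And>z g. z \<in> Z \<Longrightarrow> g \<in> carrier G \<Longrightarrow> z \<otimes> g = g \<otimes> z"
    and "g0 \<in> carrier G"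
    and cosets: "\<And>g. g \<in> carrier G \<Longrightarrow> (\<exists>h\<in>H. \<exists>k\<in>H. \<sigma> g = h \<otimes> g \<otimes> k) \<or>
      (\<exists>z\<in>Z. \<exists>h\<in>H. \<exists>k\<in>H. g = z \<otimes> (h \<otimes> g0 \<otimes> k) \<or> g = z \<otimes> (h \<otimes> \<sigma> g0 \<otimes> k))"
    and \<beta>: "contravariant_form \<beta>" and sym: "\<And>x y. \<beta> x y = \<epsilon> * \<beta> y x" "\<epsilon> * \<epsilon> = 1"
    and x: "x \<in> fixed_vectors H \<rho>" and y: "y \<in> fixed_vectors H \<rho>"
    and g0_eq: "\<beta> (\<rho> g0 x) y = \<beta> (\<rho> (\<sigma> g0) x) y"
    and g: "g \<in> carrier G"
  shows "\<beta> (\<rho> g x) y = \<epsilon> * \<beta> (\<rho> g y) x"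
proof -
  note \<beta>_act = contravariant_formD(5)[OF \<beta>]
  note \<beta>_scale = contravariant_formD(2)[OF \<beta>]
  \<comment> \<open>Applying \<open>\<sigma>\<close> to the group element amounts to exchanging the
    two vectors, up to the sign. The goal is therefore invariance of the matrix coefficient under
    \<open>\<sigma>\<close>.\<close>
  have flip: "\<beta> (\<rho> (\<sigma> g) u) v = \<epsilon> * \<beta> (\<rho> g v) u" if "g \<in> carrier G" for g u v
    using \<beta>_act[of "\<sigma> g" u v] sym(1)[of u "\<rho> g v"] that by simp
  have biinv: "\<beta> (\<rho> (h \<otimes> g \<otimes> k) u) v = \<beta> (\<rho> g u) v"
    if "h \<in> H" "k \<in> H" "g \<in> carrier G" "u \<in> fixed_vectors H \<rho>" "v \<in> fixed_vectors H \<rho>" for h k g u v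
  proof -
    have "h \<in> carrier G" "k \<in> carrier G" "\<sigma> h \<in> H" using that assms(1,2) by auto
    then show ?thesis
      using that \<beta>_act[of h "\<rho> g u" v] by (simp add: act_mult fixed_vectors_def)
  qed
  \<comment> \<open>Central elements act by scalars, which enter both sides of the goal alike; this
    is why the double cosets matter only modulo \<open>Z\<close>.\<close>
  have "\<exists>c. \<forall>v. \<rho> z v = scale c v" if "z \<in> Z" for z
  proof (rule Schur)
    show "Vector_Spaces.linear scale scale (\<rho> z)"
      using that assms(3) by (intro linear_action) auto
    show "\<rho> z (\<rho> g v) = \<rho> g (\<rho> z v)" if "g \<in> carrier G" for g v
      using that \<open>z \<in> Z\<close> assms(3,4) by (metis act_mult subsetD)
  qed
  then obtain \<chi> where "\<rho> z v = scale (\<chi> z) v" if "z \<in> Z" for z v by metis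
  then have central: "\<beta> (\<rho> (z \<otimes> g) u) v = \<chi> z * \<beta> (\<rho> g u) v"
    if "z \<in> Z" "g \<in> carrier G" for z g u v
    using that assms(3) \<beta>_scale by (auto simp: act_mult subset_iff)
  have coset: "\<beta> (\<rho> (z \<otimes> (h \<otimes> g \<otimes> k)) u) v = \<chi> z * \<beta> (\<rho> g u) v"
    if "z \<in> Z" "h \<in> H" "k \<in> H" "g \<in> carrier G" "u \<in> fixed_vectors H \<rho>" "v \<in> fixed_vectors H \<rho>"
    for z h g k u v
    using that assms(1) biinv by (subst central) (auto simp: subset_iff)
  have \<epsilon>: "\<epsilon> * (\<epsilon> * a) = a" for a
    using sym(2) by (simp add: mult.assoc[symmetric])
  have g0_eq': "\<beta> (\<rho> g0 x) y = \<epsilon> * \<beta> (\<rho> g0 y) x"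
    using g0_eq flip[OF assms(5)] by simp
  have g0_eq'': "\<beta> (\<rho> (\<sigma> g0) x) y = \<epsilon> * \<beta> (\<rho> (\<sigma> g0) y) x"
    using g0_eq flip[OF assms(5)] by (simp add: \<epsilon>)
  from cosets[OF g] show ?thesis
  proof (elim disjE bexE)
    fix h k assume "h \<in> H" "k \<in> H" "\<sigma> g = h \<otimes> g \<otimes> k"
    then show ?thesis
      using biinv[of h k g x y] flip[OF g] g x y by simp
  next
    fix z h k assume "z \<in> Z" "h \<in> H" "k \<in> H" "g = z \<otimes> (h \<otimes> g0 \<otimes> k)"
    then show ?thesis
      using coset assms(5) x y g0_eq' by (simp add: mult.left_commute)
  next
    fix z h k assume "z \<in> Z" "h \<in> H" "k \<in> H" "g = z \<otimes> (h \<otimes> \<sigma> g0 \<otimes> k)"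
    then show ?thesis
      using coset assms(5) x y g0_eq'' by (simp add: mult.left_commute)
  qed
qed

text \<open>By linearity the symmetry of matrix coefficients extends from group elements to all
  operators, and \<open>density\<close> allows an operator to be prescribed on independent fixed
  vectors.\<close>

theorem dim_fixed_vectors_le_2:
  assumes "H \<subseteq> carrier G" "\<And>h. h \<in> H \<Longrightarrow> \<sigma> h \<in> H"
    and "Z \<subseteq> carrier G" "\<And>z g. z \<in> Z \<Longrightarrow> g \<in> carrier G \<Longrightarrow> z \<otimes> g = g \<otimes> z"
    and "g0 \<in> carrier G"
    and "\<And>g. g \<in> carrier G \<Longrightarrow> (\<exists>h\<in>H. \<exists>k\<in>H. \<sigma> g = h \<otimes> g \<otimes> k) \<or>
      (\<exists>z\<in>Z. \<exists>h\<in>H. \<exists>k\<in>H. g = z \<otimes> (h \<otimes> g0 \<otimes> k) \<or> g = z \<otimes> (h \<otimes> \<sigma> g0 \<otimes> k))"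
    and "(2 :: 'f) \<noteq> 0"
  shows "dim (fixed_vectors H \<rho>) \<le> 2"
proof (rule ccontr)
  let ?W = "fixed_vectors H \<rho>"
  assume dim: "\<not> dim ?W \<le> 2"
  obtain B where B: "B \<subseteq> ?W" "independent B" "?W \<subseteq> span B" "card B = dim ?W"
    by (rule basis_exists)
  with dim have "3 \<le> card B" by simp
  then obtain C where "C \<subseteq> B" "card C = 3" "finite C"
    by (rule obtain_subset_with_card_n)
  then obtain x1 x2 x3 where C: "C = {x1, x2, x3}" "x1 \<noteq> x2" "x1 \<noteq> x3" "x2 \<noteq> x3"
    by (auto simp: card_3_iff)
  have W: "x1 \<in> ?W" "x2 \<in> ?W" "x3 \<in> ?W" and ind: "independent {x1, x2, x3}"
    using C B \<open>C \<subseteq> B\<close> independent_mono by auto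
  have W_comb: "scale a x + scale b y \<in> ?W" if "x \<in> ?W" "y \<in> ?W" for a b x y
    using that assms(1) by (auto simp: fixed_vectors_def act_add act_scale subset_iff)
  obtain \<beta> \<epsilon> where \<beta>: "contravariant_form \<beta>" "\<exists>x y. \<beta> x y \<noteq> 0"
    and \<epsilon>: "\<epsilon> = 1 \<or> \<epsilon> = -1" and sym: "\<And>x y. \<beta> x y = \<epsilon> * \<beta> y x"
    using exists_symmetric_contravariant_form by blast
  note bilin = contravariant_formD(1-4)[OF \<beta>(1)] contravariant_form_zero[OF \<beta>(1)]
  have nondeg: "y = 0" if "\<And>x. \<beta> x y = 0" for y
    using contravariant_form_nondegenerate[OF \<beta>(1)] \<beta>(2) that by blast
  have "\<epsilon> * \<epsilon> = 1" using \<epsilon> by auto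
  have coefficient: "\<beta> (\<rho> g x) y = \<epsilon> * \<beta> (\<rho> g y) x"
    if "x \<in> ?W" "y \<in> ?W" "\<beta> (\<rho> g0 x) y = \<beta> (\<rho> (\<sigma> g0) x) y" "g \<in> carrier G" for g x y
    by (rule matrix_coefficient_symmetric[of H Z g0]; fact)
  have adj_coefficient: "\<beta> (T x) y = \<epsilon> * \<beta> (T y) x"
    if "adj T T'" "x \<in> ?W" "y \<in> ?W" "\<beta> (\<rho> g0 x) y = \<beta> (\<rho> (\<sigma> g0) x) y" for T T' x y
    using that(1)
  proof induction
    case (adj_step T T' g c)
    then show ?case
      using coefficient[OF that(2-4), of g] by (simp add: bilin algebra_simps)
  qed (simp add: bilin)
  have dense: "\<exists>T T'. adj T T' \<and> T x1 = u1 \<and> T x2 = u2 \<and> T x3 = u3" for u1 u2 u3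
    using density[OF _ ind, of "\<lambda>x. if x = x1 then u1 else if x = x2 then u2 else u3"] C by auto
  \<comment> \<open>The condition at \<open>g0\<close> is the vanishing of one linear functional
    \<open>d\<close>, and \<open>d v * d u - d u * d v = 0\<close> gives a nontrivial solution in
    the plane of \<open>u\<close> and \<open>v\<close>.\<close>
  have comb: "\<exists>a b. (a \<noteq> 0 \<or> b \<noteq> 0) \<and>
      \<beta> (\<rho> g0 x) (scale a u + scale b v) = \<beta> (\<rho> (\<sigma> g0) x) (scale a u + scale b v)" for x u v
  proof -
    define d where "d w = \<beta> (\<rho> g0 x) w - \<beta> (\<rho> (\<sigma> g0) x) w" for w
    have d_comb: "d (scale a u + scale b v) = a * d u + b * d v" for a b
      by (simp add: d_def bilin algebra_simps)
    have "\<exists>a b. (a \<noteq> 0 \<or> b \<noteq> 0) \<and> d (scale a u + scale b v) = 0"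
    proof (cases "d u = 0")
      case True
      then show ?thesis
        unfolding d_comb by (intro exI[of _ 1] exI[of _ 0]) simp
    next
      case False
      then show ?thesis
        unfolding d_comb by (intro exI[of _ "d v"] exI[of _ "- d u"]) simp
    qed
    then show ?thesis
      by (simp add: d_def)
  qed
  from \<epsilon> show False
  proof
    assume \<epsilon>: "\<epsilon> = 1"
    obtain a b where ab: "a \<noteq> 0 \<or> b \<noteq> 0"
      "\<beta> (\<rho> g0 x1) (scale a x2 + scale b x3) = \<beta> (\<rho> (\<sigma> g0) x1) (scale a x2 + scale b x3)"
      using comb by blast
    define y where "y = scale a x2 + scale b x3"
    \<comment> \<open>Use an operator that sends \<open>x1\<close> to \<open>z\<close> and kills
      \<open>x2\<close> and \<open>x3\<close>, hence \<open>y\<close>.\<close>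
    have "\<beta> z y = 0" for z
    proof -
      obtain T T' where T: "adj T T'" "T x1 = z" "T x2 = 0" "T x3 = 0"
        using dense by blast
      interpret T: Vector_Spaces.linear scale scale T
        using adj_linear(1)[OF T(1)] .
      show ?thesis
        using adj_coefficient[OF T(1) W(1) W_comb[OF W(2,3)] ab(2)] T \<epsilon>
        by (simp add: y_def T.add T.scale bilin)
    qed
    then have "y = 0" by (rule nondeg)
    obtain v :: 'v where v: "v \<noteq> 0" using nonzero_space by blast
    \<comment> \<open>Independence in operator form: the images of \<open>x2\<close> and
      \<open>x3\<close> can be prescribed arbitrarily, while that of \<open>y = 0\<close> is
      zero.\<close>
    have "scale a u + scale b w = 0" for u w
    proof -
      obtain T T' where T: "adj T T'" "T x2 = u" "T x3 = w"
        using dense by blast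
      interpret T: Vector_Spaces.linear scale scale T
        using adj_linear(1)[OF T(1)] .
      have "T y = 0" using \<open>y = 0\<close> by (simp add: T.zero)
      then show ?thesis using T by (simp add: y_def T.add T.scale)
    qed
    from this[of v 0] this[of 0 v] show False
      using ab(1) v by simp
  next
    assume \<epsilon>: "\<epsilon> = -1"
    obtain a b where ab: "a \<noteq> 0 \<or> b \<noteq> 0"
      "\<beta> (\<rho> g0 x1) (scale a x1 + scale b x2) = \<beta> (\<rho> (\<sigma> g0) x1) (scale a x1 + scale b x2)"
      using comb by blast
    \<comment> \<open>With \<open>T x1 = z\<close> and \<open>T x2 = 0\<close>, the identity reads
      \<open>\<beta> z (a x1 + b x2) = - \<beta> (a z) x1\<close>. Moving the right side over
      doubles the coefficient of \<open>x1\<close>.\<close>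
    define y where "y = scale (2 * a) x1 + scale b x2"
    have "\<beta> z y = 0" for z
    proof -
      obtain T T' where T: "adj T T'" "T x1 = z" "T x2 = 0"
        using dense by blast
      interpret T: Vector_Spaces.linear scale scale T
        using adj_linear(1)[OF T(1)] .
      show ?thesis
        using adj_coefficient[OF T(1) W(1) W_comb[OF W(1,2)] ab(2)] T \<epsilon>
        by (simp add: y_def T.add T.scale bilin algebra_simps)
    qed
    then have "y = 0" by (rule nondeg)
    obtain v :: 'v where v: "v \<noteq> 0" using nonzero_space by blast
    have "scale (2 * a) u + scale b w = 0" for u w
    proof -
      obtain T T' where T: "adj T T'" "T x1 = u" "T x2 = w"
        using dense by blast
      interpret T: Vector_Spaces.linear scale scale T
        using adj_linear(1)[OF T(1)] .
      have "T y = 0" using \<open>y = 0\<close> by (simp add: T.zero)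
      then show ?thesis using T by (simp add: y_def T.add T.scale)
    qed
    from this[of v 0] this[of 0 v] show False
      using ab(1) v assms(7) by simp
  qed
qed

end

section \<open>Self-adjoint bilinear forms\<close>

abbreviation (in vector_space) functional :: "('b \<Rightarrow> 'a) \<Rightarrow> bool" where
  "functional \<phi> \<equiv> Vector_Spaces.linear scale (*) \<phi>"

lemma (in vector_space) functional_iff:
  "functional \<phi> \<longleftrightarrow> (\<forall>x y. \<phi> (x + y) = \<phi> x + \<phi> y) \<and> (\<forall>c x. \<phi> (scale c x) = c * \<phi> x)"
  by (auto simp: Vector_Spaces.linear_iff vector_space_axioms vector_space_field)

lemma (in vector_space) functionalD:
  assumes "functional \<phi>"
  shows "\<phi> (x + y) = \<phi> x + \<phi> y" "\<phi> (scale c x) = c * \<phi> x" "\<phi> 0 = 0" "\<phi> (x - y) = \<phi> x - \<phi> y"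
    "\<phi> (sum f A) = (\<Sum>i\<in>A. \<phi> (f i))"
proof -
  interpret \<phi>: Vector_Spaces.linear scale "(*)" \<phi> by fact
  show "\<phi> (x + y) = \<phi> x + \<phi> y" "\<phi> (scale c x) = c * \<phi> x" "\<phi> 0 = 0" "\<phi> (x - y) = \<phi> x - \<phi> y"
    "\<phi> (sum f A) = (\<Sum>i\<in>A. \<phi> (f i))"
    by (simp_all add: \<phi>.add \<phi>.scale \<phi>.zero \<phi>.diff \<phi>.sum)
qed

lemma (in vector_space) functional_extend:
  assumes "independent B"
  shows "\<exists>\<phi>. functional \<phi> \<and> (\<forall>b\<in>B. \<phi> b = f b)"
proof -
  interpret vector_space_pair scale "(*)"
    by (simp add: vector_space_pair_def vector_space_axioms vector_space_field)
  show ?thesis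
    using linear_independent_extend[OF assms] by blast
qed

lemma (in vector_space) linear_funpow: "Vector_Spaces.linear scale scale T \<Longrightarrow> Vector_Spaces.linear scale scale (T ^^ i)"
  by (induction i) (auto simp: Vector_Spaces.linear_iff)

lemma (in vector_space) functional_funpow:
  "functional \<phi> \<Longrightarrow> Vector_Spaces.linear scale scale T \<Longrightarrow> functional (\<lambda>x. \<phi> ((T ^^ i) x))"
  using linear_funpow[of T i] by (auto simp: functional_iff Vector_Spaces.linear_iff)

definition (in vector_space) bilinear_form :: "('b \<Rightarrow> 'b \<Rightarrow> 'a) \<Rightarrow> bool" where
  "bilinear_form \<beta> \<longleftrightarrow> (\<forall>x. functional (\<beta> x)) \<and> (\<forall>y. functional (\<lambda>x. \<beta> x y))"

definition (in vector_space) nondegenerate_on :: "'b set \<Rightarrow> ('b \<Rightarrow> 'b \<Rightarrow> 'a) \<Rightarrow> bool" where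
  "nondegenerate_on U \<beta> \<longleftrightarrow> (\<forall>x\<in>U. (\<forall>y\<in>U. \<beta> x y = 0) \<longrightarrow> x = 0)"

text \<open>Induction on \<open>k\<close>. Independence on \<open>U\<close> provides
  \<open>u\<close> at which the last functional differs from the combination of earlier ones with
  the same values on the \<open>w i\<close>. Subtracting from \<open>u\<close> its components along
  the \<open>w i\<close> and normalising gives the new dual vector, by whose multiples the old ones
  are corrected.\<close>

lemma (in vector_space) dual_family:
  fixes k :: nat
  assumes "subspace U" "\<And>i. i < k \<Longrightarrow> functional (\<phi> i)"
    and "\<And>c. (\<And>u. u \<in> U \<Longrightarrow> (\<Sum>i<k. c i * \<phi> i u) = 0) \<Longrightarrow> \<forall>i<k. c i = 0"
  shows "\<exists>w. \<forall>j<k. w j \<in> U \<and> (\<forall>i<k. \<phi> i (w j) = (if i = j then 1 else 0))"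
  using assms(2,3)
proof (induction k)
  case (Suc k)
  have "\<exists>w. \<forall>j<k. w j \<in> U \<and> (\<forall>i<k. \<phi> i (w j) = (if i = j then 1 else 0))"
  proof (rule Suc.IH)
    fix c assume "\<And>u. u \<in> U \<Longrightarrow> (\<Sum>i<k. c i * \<phi> i u) = 0"
    then show "\<forall>i<k. c i = 0"
      using Suc.prems(2)[of "c(k := 0)"] by (auto simp: less_Suc_eq)
  qed (simp add: Suc.prems(1))
  then obtain w where w: "\<And>j. j < k \<Longrightarrow> w j \<in> U"
    "\<And>i j. i < k \<Longrightarrow> j < k \<Longrightarrow> \<phi> i (w j) = (if i = j then 1 else 0)"
    by blast
  note \<phi> = functionalD[OF Suc.prems(1)]
  have "\<exists>u\<in>U. \<phi> k u - (\<Sum>i<k. \<phi> k (w i) * \<phi> i u) \<noteq> 0"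
  proof (rule ccontr)
    assume "\<not> ?thesis"
    then have "\<forall>i<Suc k. (if i = k then 1 else - \<phi> k (w i)) = 0"
      by (intro Suc.prems(2)) (auto simp: sum_negf)
    then show False by (metis lessI zero_neq_one)
  qed
  then obtain u where u: "u \<in> U" "\<phi> k u - (\<Sum>i<k. \<phi> k (w i) * \<phi> i u) \<noteq> 0"
    by blast
  define z where "z = u - (\<Sum>i<k. scale (\<phi> i u) (w i))"
  define z' where "z' = scale (1 / \<phi> k z) z"
  have z: "z \<in> U"
    using u w(1) unfolding z_def
    by (intro subspace_diff subspace_sum subspace_scale assms(1)) auto
  have zk: "\<phi> k z = \<phi> k u - (\<Sum>i<k. \<phi> k (w i) * \<phi> i u)"
    by (simp add: z_def \<phi> mult.commute)
  have zj: "\<phi> j z = 0" if "j < k" for j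
  proof -
    have "(\<Sum>i<k. \<phi> i u * \<phi> j (w i)) = (\<Sum>i<k. if i = j then \<phi> j u else 0)"
      using that w(2) by (intro sum.cong) auto
    then show ?thesis using that by (simp add: z_def \<phi>)
  qed
  have z': "z' \<in> U" "\<phi> k z' = 1" "\<And>j. j < k \<Longrightarrow> \<phi> j z' = 0"
    using z u(2) zk zj by (auto simp: z'_def \<phi> intro: subspace_scale assms(1))
  define w' where "w' j = (if j = k then z' else w j - scale (\<phi> k (w j)) z')" for j
  have "w' j \<in> U" if "j < Suc k" for j
    using that w(1) z'(1) unfolding w'_def
    by (auto intro!: subspace_diff subspace_scale assms(1))
  moreover have "\<phi> i (w' j) = (if i = j then 1 else 0)" if "i < Suc k" "j < Suc k" for i j
    using that w(2) z' by (cases "i = k"; cases "j = k") (auto simp: w'_def \<phi>)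
  ultimately show ?case by blast
qed simp

text \<open>Indexed so that a repeated vector counts as a dependency, which the image set would not
  record.\<close>

definition (in vector_space) independent_family :: "nat \<Rightarrow> (nat \<Rightarrow> 'b) \<Rightarrow> bool" where
  "independent_family k f \<longleftrightarrow> (\<forall>c. (\<Sum>i<k. scale (c i) (f i)) = 0 \<longrightarrow> (\<forall>i<k. c i = 0))"

lemma (in vector_space) independent_familyD:
  assumes "independent_family k f"
  shows "inj_on f {..<k}" "independent (f ` {..<k})"
proof -
  show inj: "inj_on f {..<k}"
  proof (rule inj_onI, rule ccontr)
    fix i j assume ij: "i \<in> {..<k}" "j \<in> {..<k}" "f i = f j" "i \<noteq> j"
    define c :: "nat \<Rightarrow> 'a" where "c l = (if l = i then 1 else if l = j then -1 else 0)" for l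
    have "(\<Sum>l<k. scale (c l) (f l)) = (\<Sum>l\<in>{i,j}. scale (c l) (f l))"
      using ij by (intro sum.mono_neutral_right) (auto simp: c_def)
    also have "\<dots> = 0"
      using ij by (simp add: c_def)
    finally have "c i = 0"
      using assms ij by (auto simp: independent_family_def)
    then show False by (simp add: c_def)
  qed
  show "independent (f ` {..<k})"
    using assms inj unfolding independent_family_def
    by (auto simp: dependent_finite sum.reindex)
qed

lemma (in vector_space) independent_family_extend:
  assumes "independent_family k f"
  shows "\<exists>\<phi>. functional \<phi> \<and> (\<forall>i<k. \<phi> (f i) = y i)"
proof -
  obtain \<phi> where \<phi>: "functional \<phi>" "\<forall>b\<in>f ` {..<k}. \<phi> b = y (inv_into {..<k} f b)"
    using functional_extend[OF independent_familyD(2)[OF assms], of "\<lambda>b. y (inv_into {..<k} f b)"] by blast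
  then have "\<forall>i<k. \<phi> (f i) = y i"
    using independent_familyD(1)[OF assms] by (auto simp: inv_into_f_f)
  then show ?thesis using \<phi> by blast
qed

text \<open>The matrix with entries \<open>h (i + j)\<close> is 0 for \<open>i + j < k - 1\<close>
  and 1 for \<open>i + j = k - 1\<close>. If \<open>c m\<close> is the last nonzero coefficient, the
  equation for \<open>j = k - 1 - m\<close> reduces to \<open>c m = 0\<close>.\<close>

lemma Hankel_nonsingular:
  fixes h :: "nat \<Rightarrow> 'f::field"
  assumes "\<And>l. l < k \<Longrightarrow> h l = (if Suc l = k then 1 else 0)"
    and "\<And>j. j < k \<Longrightarrow> (\<Sum>i<k. c i * h (i + j)) = 0"
    and "i < k"
  shows "c i = 0"
proof (rule ccontr)
  assume "c i \<noteq> 0"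
  define m where "m = Max {i. i < k \<and> c i \<noteq> 0}"
  have "{i. i < k \<and> c i \<noteq> 0} \<noteq> {}"
    using assms(3) \<open>c i \<noteq> 0\<close> by auto
  then have "m \<in> {i. i < k \<and> c i \<noteq> 0}"
    unfolding m_def by (intro Max_in) auto
  moreover have max: "c l = 0" if "m < l" "l < k" for l
    using that Max_ge[of "{i. i < k \<and> c i \<noteq> 0}" l] unfolding m_def by fastforce
  ultimately have m: "m < k" "c m \<noteq> 0" by auto
  have "c l * h (l + (k - 1 - m)) = (if l = m then c m else 0)" if "l < k" for l
    using that m max[of l] assms(1)[of "l + (k - 1 - m)"]
    by (cases l m rule: linorder_cases) auto
  then have "(\<Sum>l<k. c l * h (l + (k - 1 - m))) = c m"
    using m by simp
  then show False
    using assms(2)[of "k - 1 - m"] m by simp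
qed


text \<open>Chains of vectors and chains of functionals are measured together, so that at the
  largest \<open>k\<close> neither kind can be prolonged. The two maxima need not be
  compared.\<close>

definition (in vector_space) cyclic_size :: "'b set \<Rightarrow> ('b \<Rightarrow> 'b) \<Rightarrow> nat \<Rightarrow> bool" where
  "cyclic_size U T k \<longleftrightarrow> (\<exists>v\<in>U. independent_family k (\<lambda>i. (T ^^ i) v)) \<or>
    (\<exists>\<phi>. functional \<phi> \<and> (\<forall>c. (\<forall>u\<in>U. (\<Sum>i<k. c i * \<phi> ((T ^^ i) u)) = 0) \<longrightarrow> (\<forall>i<k. c i = 0)))"

lemma funpow_closed: "(\<And>u. u \<in> U \<Longrightarrow> T u \<in> U) \<Longrightarrow> u \<in> U \<Longrightarrow> (T ^^ i) u \<in> U"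
  by (induction i) auto

text \<open>The vectors \<open>v, T v, T\<^sup>2 v, \<dots>\<close> and the functionals \<open>\<phi>, \<phi> T, \<phi> T\<^sup>2, \<dots>\<close> are
  paired by a Hankel matrix which is antitriangular with ones on the antidiagonal. By maximality of
  \<open>k\<close> both their span and their common kernel are stable under \<open>T\<close>.\<close>

lemma (in vector_space) exists_cyclic_pair:
  assumes T: "Vector_Spaces.linear scale scale T" and U: "subspace U" "T ` U \<subseteq> U"
    and bound: "\<forall>k f. (\<forall>i<k. f i \<in> U) \<and> independent_family k f \<longrightarrow> k \<le> m"
    and "U \<noteq> {0}"
  obtains v \<phi> k c e where "v \<in> U" "functional \<phi>" "k > 0"
    "\<And>i. i < k \<Longrightarrow> \<phi> ((T ^^ i) v) = (if Suc i = k then 1 else 0)"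
    "(T ^^ k) v = (\<Sum>i<k. scale (c i) ((T ^^ i) v))"
    "\<And>u. u \<in> U \<Longrightarrow> \<phi> ((T ^^ k) u) = (\<Sum>i<k. e i * \<phi> ((T ^^ i) u))"
proof -
  have pow_U: "(T ^^ i) u \<in> U" if "u \<in> U" for i u
    using funpow_closed[of U T u i] U(2) that by blast
  have dual: "\<exists>w. \<forall>j<k. w j \<in> U \<and> (\<forall>i<k. \<phi> ((T ^^ i) (w j)) = (if i = j then 1 else 0))"
    if "functional \<phi>" "\<And>c. (\<And>u. u \<in> U \<Longrightarrow> (\<Sum>i<k. c i * \<phi> ((T ^^ i) u)) = 0) \<Longrightarrow> \<forall>i<k. c i = 0"
    for \<phi> k
    using U(1) functional_funpow[OF that(1) T] that(2) by (rule dual_family)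
  have size_le: "k \<le> m" if "cyclic_size U T k" for k
    using that unfolding cyclic_size_def
  proof (elim disjE bexE exE conjE)
    fix v assume "v \<in> U" "independent_family k (\<lambda>i. (T ^^ i) v)"
    then show ?thesis
      using bound[rule_format, of k "\<lambda>i. (T ^^ i) v"] pow_U by auto
  next
    fix \<phi> assume \<phi>: "functional \<phi>"
      and ind: "\<forall>c. (\<forall>u\<in>U. (\<Sum>i<k. c i * \<phi> ((T ^^ i) u)) = 0) \<longrightarrow> (\<forall>i<k. c i = 0)"
    \<comment> \<open>A chain of functionals is bounded through its dual vectors, which form an
      independent family in \<open>U\<close>.\<close>
    obtain w where w: "\<And>j. j < k \<Longrightarrow> w j \<in> U"
      "\<And>i j. i < k \<Longrightarrow> j < k \<Longrightarrow> \<phi> ((T ^^ i) (w j)) = (if i = j then 1 else 0)"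
      using dual[OF \<phi>, of k] ind by blast
    have "c i = 0" if "(\<Sum>j<k. scale (c j) (w j)) = 0" "i < k" for c i
    proof -
      have "0 = \<phi> ((T ^^ i) (\<Sum>j<k. scale (c j) (w j)))"
        using that functionalD(3)[OF functional_funpow[OF \<phi> T]] by simp
      also have "\<dots> = (\<Sum>j<k. c j * \<phi> ((T ^^ i) (w j)))"
        by (simp add: functionalD[OF functional_funpow[OF \<phi> T]])
      also have "\<dots> = (\<Sum>j<k. if j = i then c i else 0)"
        using w(2) that(2) by (intro sum.cong) auto
      finally show ?thesis using that by simp
    qed
    then have "independent_family k w"
      by (auto simp: independent_family_def)
    then show ?thesis
      using w(1) bound[rule_format, of k w] by auto
  qed
  obtain u where u: "u \<in> U" "u \<noteq> 0"
    using assms(5) U(1) subspace_0 by blast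
  then have "cyclic_size U T 1"
    unfolding cyclic_size_def independent_family_def by (intro disjI1 bexI[of _ u]) auto
  then obtain k where k: "cyclic_size U T k" "\<And>l. cyclic_size U T l \<Longrightarrow> l \<le> k"
    using GreatestI_nat[of "cyclic_size U T" 1 m] Greatest_le_nat[of "cyclic_size U T" _ m] size_le
    by blast
  have "k > 0" using k(2)[OF \<open>cyclic_size U T 1\<close>] by simp
  \<comment> \<open>A chain of vectors admits a functional with these values; for a chain of
    functionals the last dual vector has them.\<close>
  have "\<exists>v\<in>U. \<exists>\<phi>. functional \<phi> \<and> (\<forall>i<k. \<phi> ((T ^^ i) v) = (if Suc i = k then 1 else 0))"
    using k(1) unfolding cyclic_size_def
  proof (elim disjE bexE exE conjE)
    fix v assume "v \<in> U" "independent_family k (\<lambda>i. (T ^^ i) v)"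
    then show ?thesis
      using independent_family_extend[of k "\<lambda>i. (T ^^ i) v" "\<lambda>i. if Suc i = k then 1 else 0"]
      by blast
  next
    fix \<phi> assume \<phi>: "functional \<phi>"
      and ind: "\<forall>c. (\<forall>u\<in>U. (\<Sum>i<k. c i * \<phi> ((T ^^ i) u)) = 0) \<longrightarrow> (\<forall>i<k. c i = 0)"
    obtain w where w: "\<And>j. j < k \<Longrightarrow> w j \<in> U"
      "\<And>i j. i < k \<Longrightarrow> j < k \<Longrightarrow> \<phi> ((T ^^ i) (w j)) = (if i = j then 1 else 0)"
      using dual[OF \<phi>, of k] ind by blast
    then show ?thesis
      using \<phi> \<open>k > 0\<close> by (intro bexI[of _ "w (k - 1)"] exI[of _ \<phi>]) auto
  qed
  then obtain v \<phi> where v: "v \<in> U" and \<phi>: "functional \<phi>"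
    and pair: "\<And>i. i < k \<Longrightarrow> \<phi> ((T ^^ i) v) = (if Suc i = k then 1 else 0)"
    by blast
  note \<phi>_pow = functionalD[OF functional_funpow[OF \<phi> T]]
  have pow_pow: "(T ^^ j) ((T ^^ i) x) = (T ^^ (i + j)) x" for i j x
    by (subst add.commute) (simp add: funpow_add)
  have ind: "c i = 0" if "(\<Sum>i<k. scale (c i) ((T ^^ i) v)) = 0" "i < k" for c i
  proof (rule Hankel_nonsingular[of k "\<lambda>i. \<phi> ((T ^^ i) v)", OF pair _ \<open>i < k\<close>])
    fix j assume "j < k"
    have "0 = \<phi> ((T ^^ j) (\<Sum>i<k. scale (c i) ((T ^^ i) v)))"
      using that \<phi>_pow(3) by simp
    also have "\<dots> = (\<Sum>i<k. c i * \<phi> ((T ^^ (i + j)) v))"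
      by (simp add: \<phi>_pow pow_pow)
    finally show "(\<Sum>i<k. c i * \<phi> ((T ^^ (i + j)) v)) = 0" by simp
  qed
  have coind: "c i = 0" if "\<And>u. u \<in> U \<Longrightarrow> (\<Sum>i<k. c i * \<phi> ((T ^^ i) u)) = 0" "i < k" for c i
  proof (rule Hankel_nonsingular[of k "\<lambda>i. \<phi> ((T ^^ i) v)", OF pair _ \<open>i < k\<close>])
    fix j assume "j < k"
    show "(\<Sum>i<k. c i * \<phi> ((T ^^ (i + j)) v)) = 0"
      using that(1)[OF pow_U[OF v], of j] by (simp add: funpow_add)
  qed
  \<comment> \<open>Neither chain can be prolonged to length \<open>k + 1\<close>. In the resulting
    relations the top coefficient is nonzero because the first \<open>k\<close> terms are
    independent, so the \<open>k\<close>-th term can be solved for.\<close>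
  have max: "\<not> cyclic_size U T (Suc k)"
    using k(2) by force
  then have "\<not> independent_family (Suc k) (\<lambda>i. (T ^^ i) v)"
    using v unfolding cyclic_size_def by blast
  then obtain c where c: "(\<Sum>i<k. scale (c i) ((T ^^ i) v)) + scale (c k) ((T ^^ k) v) = 0" "\<not> (\<forall>i<Suc k. c i = 0)"
    by (auto simp: independent_family_def)
  have "c k \<noteq> 0"
    using ind[of c] c by (auto simp: less_Suc_eq)
  have "scale (- 1 / c k) ((\<Sum>i<k. scale (c i) ((T ^^ i) v)) + scale (c k) ((T ^^ k) v)) = 0"
    using c by simp
  then have "(T ^^ k) v = (\<Sum>i<k. scale (- 1 / c k * c i) ((T ^^ i) v))"
    using \<open>c k \<noteq> 0\<close> by (simp add: scale_right_distrib scale_sum_right)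
  moreover have "\<exists>e. (\<forall>u\<in>U. (\<Sum>i<Suc k. e i * \<phi> ((T ^^ i) u)) = 0) \<and> \<not> (\<forall>i<Suc k. e i = 0)"
    using max \<phi> unfolding cyclic_size_def by blast
  then obtain e where e: "\<And>u. u \<in> U \<Longrightarrow> (\<Sum>i<k. e i * \<phi> ((T ^^ i) u)) + e k * \<phi> ((T ^^ k) u) = 0"
    "\<not> (\<forall>i<Suc k. e i = 0)"
    by auto
  have "e k \<noteq> 0"
    using coind[of e] e by (auto simp: less_Suc_eq)
  have "\<phi> ((T ^^ k) u) = (\<Sum>i<k. - e i / e k * \<phi> ((T ^^ i) u))" if "u \<in> U" for u
  proof -
    have "\<phi> ((T ^^ k) u) = - (\<Sum>i<k. e i * \<phi> ((T ^^ i) u)) / e k"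
      using e(1)[OF that] \<open>e k \<noteq> 0\<close> by (simp add: field_simps eq_neg_iff_add_eq_0)
    then show ?thesis
      by (simp add: sum_divide_distrib sum_negf)
  qed
  ultimately show thesis
    using v \<phi> \<open>k > 0\<close> pair
    by (intro that[of v \<phi> k "\<lambda>i. - 1 / c k * c i" "\<lambda>i. - e i / e k"])
qed


definition (in vector_space) selfadjoint_on :: "'b set \<Rightarrow> ('b \<Rightarrow> 'b) \<Rightarrow> ('b \<Rightarrow> 'b \<Rightarrow> 'a) \<Rightarrow> bool" where
  "selfadjoint_on U T \<beta> \<longleftrightarrow> (\<forall>x\<in>U. \<forall>y\<in>U. \<beta> (T x) y = \<beta> x (T y))"

text \<open>Induction on a bound for the dimension. \<open>U\<close> is the direct sum of the span
  \<open>W\<close> of the chain of \<open>v\<close> and the common kernel \<open>K\<close> of the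
  chain of \<open>\<phi>\<close>, both stable under \<open>T\<close>. On \<open>W\<close> the form
  takes the value \<open>\<phi> ((T ^^ (a + b)) v)\<close> at \<open>(T ^^ a) v\<close> and
  \<open>(T ^^ b) v\<close>, which is visibly self-adjoint; \<open>K\<close> is left to the
  induction hypothesis.\<close>

lemma (in vector_space) exists_selfadjoint_form_aux:
  assumes T: "Vector_Spaces.linear scale scale T" and U: "subspace U" "T ` U \<subseteq> U"
    and "\<forall>k f. (\<forall>i<k. f i \<in> U) \<and> independent_family k f \<longrightarrow> k \<le> m"
  shows "\<exists>\<beta>. bilinear_form \<beta> \<and> nondegenerate_on U \<beta> \<and> selfadjoint_on U T \<beta>"
  using assms(2-)
proof (induction m arbitrary: U)
  case 0
  have "x = 0" if "x \<in> U" for x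
    using 0(3)[rule_format, of 1 "\<lambda>_. x"] that by (auto simp: independent_family_def)
  then show ?case
    by (intro exI[of _ "\<lambda>_ _. 0"])
      (auto simp: bilinear_form_def functional_iff nondegenerate_on_def selfadjoint_on_def)
next
  case (Suc m)
  show ?case
  proof (cases "U = {0}")
    case True
    then show ?thesis
      by (intro exI[of _ "\<lambda>_ _. 0"])
        (auto simp: bilinear_form_def functional_iff nondegenerate_on_def selfadjoint_on_def)
  next
    case False
    interpret T: Vector_Spaces.linear scale scale T by fact
    have pow_U: "(T ^^ i) u \<in> U" if "u \<in> U" for i u
      using funpow_closed[of U T u i] Suc.prems(2) that by blast
    show ?thesis
    proof (rule exists_cyclic_pair[OF T Suc.prems False])
      fix v \<phi> k c e
      assume v: "v \<in> U" and \<phi>: "functional \<phi>" and "k > 0"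
        and pair: "\<And>i. i < k \<Longrightarrow> \<phi> ((T ^^ i) v) = (if Suc i = k then 1 else 0)"
        and c: "(T ^^ k) v = (\<Sum>i<k. scale (c i) ((T ^^ i) v))"
        and e: "\<And>u. u \<in> U \<Longrightarrow> \<phi> ((T ^^ k) u) = (\<Sum>i<k. e i * \<phi> ((T ^^ i) u))"
      note \<phi>_pow = functionalD[OF functional_funpow[OF \<phi> T]]
          have pow_pow: "(T ^^ j) ((T ^^ i) x) = (T ^^ (i + j)) x" for i j x
        by (subst add.commute) (simp add: funpow_add)
      have T_pow_v: "T ((T ^^ i) x) = (T ^^ Suc i) x" "(T ^^ i) (T x) = (T ^^ Suc i) x" for i x
        by (simp_all add: funpow_swap1)
      define W where "W = range (\<lambda>a. \<Sum>i<k. scale (a i) ((T ^^ i) v))"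
      define K where "K = {u \<in> U. \<forall>i<k. \<phi> ((T ^^ i) u) = 0}"
      have W_coeffs: "\<exists>a. x = (\<Sum>i<k. scale (a i) ((T ^^ i) v))" if "x \<in> W" for x
        using that by (auto simp: W_def)
      have W: "subspace W"
        unfolding subspace_def W_def
      proof (safe)
        show "0 \<in> range (\<lambda>a. \<Sum>i<k. scale (a i) ((T ^^ i) v))"
          by (rule range_eqI[of _ _ "\<lambda>_. 0"]) simp
        show "(\<Sum>i<k. scale (a i) ((T ^^ i) v)) + (\<Sum>i<k. scale (b i) ((T ^^ i) v))
            \<in> range (\<lambda>a. \<Sum>i<k. scale (a i) ((T ^^ i) v))" for a b
          by (rule range_eqI[of _ _ "\<lambda>i. a i + b i"]) (simp add: scale_left_distrib sum.distrib)
        show "scale r (\<Sum>i<k. scale (a i) ((T ^^ i) v))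
            \<in> range (\<lambda>a. \<Sum>i<k. scale (a i) ((T ^^ i) v))" for r a
          by (rule range_eqI[of _ _ "\<lambda>i. r * a i"]) (simp add: scale_sum_right)
      qed
      have K: "subspace K"
        unfolding subspace_def K_def using Suc.prems(1)
        by (auto simp: \<phi>_pow subspace_0 subspace_add subspace_scale)
      have W_U: "x \<in> U" if "x \<in> W" for x
        using that v pow_U Suc.prems(1) unfolding W_def
        by (auto intro!: subspace_sum subspace_scale)
      have pow_W: "(T ^^ i) v \<in> W" if "i \<le> k" for i
      proof (cases "i = k")
        case True
        then show ?thesis using c by (auto simp: W_def)
      next
        case False
        have "(\<Sum>j<k. scale (if j = i then 1 else 0) ((T ^^ j) v)) = (\<Sum>j<k. if j = i then (T ^^ i) v else 0)"
          by (intro sum.cong) auto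
        also have "\<dots> = (T ^^ i) v" using that False by simp
        finally show ?thesis
          unfolding W_def by (intro range_eqI[of _ _ "\<lambda>j. if j = i then 1 else 0"]) simp
      qed
      have T_W: "T x \<in> W" if "x \<in> W" for x
      proof -
        obtain a where "x = (\<Sum>i<k. scale (a i) ((T ^^ i) v))"
          using W_coeffs[OF \<open>x \<in> W\<close>] by blast
        then have "T x = (\<Sum>i<k. scale (a i) ((T ^^ Suc i) v))"
          by (simp only: T.sum T.scale T_pow_v)
        also have "\<dots> \<in> W"
          by (intro subspace_sum subspace_scale W pow_W) auto
        finally show ?thesis .
      qed
      have T_K: "T x \<in> K" if "x \<in> K" for x
      proof -
        have "\<phi> ((T ^^ Suc i) x) = 0" if "i < k" for i
        proof (cases "Suc i = k")
          case True
          have "\<phi> ((T ^^ k) x) = 0"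
            using e[of x] \<open>x \<in> K\<close> by (simp add: K_def)
          then show ?thesis unfolding True .
        next
          case False
          then have "Suc i < k" using that by simp
          then show ?thesis using \<open>x \<in> K\<close> unfolding K_def by blast
        qed
        then show ?thesis
          using that Suc.prems(2) by (auto simp: K_def T_pow_v simp del: funpow.simps)
      qed
      have W_zero: "x = 0" if "x \<in> W" "\<And>i. i < k \<Longrightarrow> \<phi> ((T ^^ i) x) = 0" for x
      proof -
        obtain a where a: "x = (\<Sum>i<k. scale (a i) ((T ^^ i) v))"
          using W_coeffs[OF \<open>x \<in> W\<close>] by blast
        have "a i = 0" if "i < k" for i
        proof (rule Hankel_nonsingular[of k "\<lambda>i. \<phi> ((T ^^ i) v)", OF pair _ \<open>i < k\<close>])
          fix j assume "j < k"
          then have "0 = \<phi> ((T ^^ j) x)"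
            using \<open>\<And>i. i < k \<Longrightarrow> \<phi> ((T ^^ i) x) = 0\<close> by simp
          also have "\<dots> = (\<Sum>i<k. a i * \<phi> ((T ^^ (i + j)) v))"
            by (simp add: a \<phi>_pow pow_pow)
          finally show "(\<Sum>i<k. a i * \<phi> ((T ^^ (i + j)) v)) = 0" by simp
        qed
        then show ?thesis by (simp add: a)
      qed
      have "\<exists>w. \<forall>j<k. w j \<in> W \<and> (\<forall>i<k. \<phi> ((T ^^ i) (w j)) = (if i = j then 1 else 0))"
        using W functional_funpow[OF \<phi> T]
      proof (rule dual_family)
        fix a assume a: "\<And>u. u \<in> W \<Longrightarrow> (\<Sum>i<k. a i * \<phi> ((T ^^ i) u)) = 0"
        have "a i = 0" if "i < k" for i
        proof (rule Hankel_nonsingular[of k "\<lambda>i. \<phi> ((T ^^ i) v)", OF pair _ that])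
          fix j assume "j < k"
          then show "(\<Sum>i<k. a i * \<phi> ((T ^^ (i + j)) v)) = 0"
            using a[OF pow_W[of j]] by (simp add: pow_pow add.commute)
        qed
        then show "\<forall>i<k. a i = 0" by blast
      qed
      then obtain w where w: "\<And>j. j < k \<Longrightarrow> w j \<in> W"
        "\<And>i j. i < k \<Longrightarrow> j < k \<Longrightarrow> \<phi> ((T ^^ i) (w j)) = (if i = j then 1 else 0)"
        by blast
      have "\<forall>j. \<exists>a. j < k \<longrightarrow> w j = (\<Sum>i<k. scale (a i) ((T ^^ i) v))"
        using w(1) unfolding W_def by blast
      then obtain a where a: "\<And>j. j < k \<Longrightarrow> w j = (\<Sum>i<k. scale (a j i) ((T ^^ i) v))"
        by metis
      \<comment> \<open>On \<open>U\<close>, \<open>p\<close> is the projection onto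
        \<open>W\<close> along \<open>K\<close>: it only uses the values that vanish on
        \<open>K\<close>.\<close>
      define p where "p x = (\<Sum>j<k. scale (\<phi> ((T ^^ j) x)) (w j))" for x
      \<comment> \<open>The Hankel form described above, expressed through the dual vectors so that
        it is bilinear on the whole type; \<open>\<gamma>_pow\<close> recovers its values on the
        chain.\<close>
      define \<gamma> where "\<gamma> x y = (\<Sum>j<k. \<phi> ((T ^^ j) x) * (\<Sum>i<k. a j i * \<phi> ((T ^^ i) y)))" for x y
      have p_linear: "p (x + y) = p x + p y" "p (scale r x) = scale r (p x)" for x y r
        by (simp_all add: p_def \<phi>_pow scale_left_distrib sum.distrib scale_sum_right)
      have p_W: "p x \<in> W" for x
        unfolding p_def using w(1) by (intro subspace_sum subspace_scale W) auto
      have \<phi>_p: "\<phi> ((T ^^ i) (p x)) = \<phi> ((T ^^ i) x)" if "i < k" for i x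
      proof -
        have "\<phi> ((T ^^ i) (p x)) = (\<Sum>j<k. \<phi> ((T ^^ j) x) * \<phi> ((T ^^ i) (w j)))"
          by (simp add: p_def \<phi>_pow)
        also have "\<dots> = (\<Sum>j<k. if j = i then \<phi> ((T ^^ i) x) else 0)"
          using w(2) that by (intro sum.cong) auto
        finally show ?thesis using that by simp
      qed
      have p_id: "p x = x" if "x \<in> W" for x
        using W_zero[of "p x - x"] that p_W \<phi>_p by (simp add: subspace_diff W \<phi>_pow)
      have p_K: "p x = 0" if "x \<in> K" for x
        using that by (simp add: p_def K_def)
      have diff_K: "x - p x \<in> K" if "x \<in> U" for x
        using that W_U[OF p_W[of x]] Suc.prems(1) by (simp add: K_def \<phi>_p \<phi>_pow subspace_diff)
      have p_T: "p (T x) = T (p x)" if "x \<in> U" for x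
      proof -
        have "T x = T (p x) + T (x - p x)"
          by (simp add: T.diff)
        then have "p (T x) = p (T (p x)) + p (T (x - p x))"
          by (metis p_linear(1))
        then show ?thesis
          using that p_W by (simp add: p_id T_W p_K T_K diff_K)
      qed
      have \<gamma>_bilinear: "\<gamma> (x + x') y = \<gamma> x y + \<gamma> x' y" "\<gamma> (scale r x) y = r * \<gamma> x y"
        "\<gamma> x (y + y') = \<gamma> x y + \<gamma> x y'" "\<gamma> x (scale r y) = r * \<gamma> x y" for x x' y y' r
        by (simp_all add: \<gamma>_def \<phi>_pow sum.distrib sum_distrib_left algebra_simps)
      have \<gamma>_pow: "\<gamma> x ((T ^^ b) v) = \<phi> ((T ^^ b) (p x))" for x b
      proof -
        have "(\<Sum>i<k. a j i * \<phi> ((T ^^ i) ((T ^^ b) v))) = \<phi> ((T ^^ b) (w j))" if "j < k" for j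
          using a[OF that] by (simp add: \<phi>_pow pow_pow add.commute)
        then show ?thesis
          by (simp add: \<gamma>_def p_def \<phi>_pow)
      qed
      have \<gamma>_K: "\<gamma> x y = 0" if "y \<in> K" for x y
        using that by (simp add: \<gamma>_def K_def)
      have \<gamma>_functional: "functional (\<gamma> x)" for x
        by (simp add: functional_iff \<gamma>_bilinear)
      have \<gamma>_W: "\<gamma> (T x) y = \<gamma> x (T y)" if "x \<in> U" "y \<in> W" for x y
      proof -
        obtain b where b: "y = (\<Sum>i<k. scale (b i) ((T ^^ i) v))"
          using W_coeffs[OF \<open>y \<in> W\<close>] by blast
        then have Ty: "T y = (\<Sum>i<k. scale (b i) ((T ^^ Suc i) v))"
          by (simp only: T.sum T.scale T_pow_v)
        have "\<gamma> (T x) y = (\<Sum>i<k. b i * \<phi> ((T ^^ i) (T (p x))))"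
          by (simp add: b functionalD[OF \<gamma>_functional] \<gamma>_pow p_T that(1))
        also have "\<dots> = \<gamma> x (T y)"
          unfolding Ty by (simp add: functionalD[OF \<gamma>_functional] \<gamma>_pow T_pow_v del: funpow.simps)
        finally show ?thesis .
      qed
      have \<gamma>_selfadjoint: "\<gamma> (T x) y = \<gamma> x (T y)" if "x \<in> U" "y \<in> U" for x y
      proof -
        have "T y = T (p y) + T (y - p y)" by (simp add: T.diff)
        then have "\<gamma> x (T y) = \<gamma> x (T (p y)) + \<gamma> x (T (y - p y))"
          by (metis \<gamma>_bilinear(3))
        moreover have "\<gamma> (T x) y = \<gamma> (T x) (p y) + \<gamma> (T x) (y - p y)"
          by (metis \<gamma>_bilinear(3) add.commute diff_add_cancel)
        ultimately show ?thesis
          using that \<gamma>_W[OF that(1) p_W] by (simp add: \<gamma>_K T_K diff_K)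
      qed
      \<comment> \<open>The bound drops by one on \<open>K\<close>: adjoining \<open>v\<close>
        preserves independence, since \<open>\<phi>\<close> after \<open>T ^^ (k - 1)\<close> is
        zero on \<open>K\<close> and 1 at \<open>v\<close>.\<close>
      have "l \<le> m" if f: "\<forall>i<l. f i \<in> K" and ind: "independent_family l f" for l f
      proof -
        have "independent_family (Suc l) (f(l := v))"
          unfolding independent_family_def
        proof (intro allI impI)
          fix d i assume d: "(\<Sum>i<Suc l. scale (d i) ((f(l := v)) i)) = 0" and i: "i < Suc l"
          have sum: "(\<Sum>i<l. scale (d i) (f i)) + scale (d l) v = 0"
            using d by simp
          have "(\<Sum>i<l. scale (d i) (f i)) \<in> K"
            using f by (intro subspace_sum subspace_scale K) auto
          then have "\<phi> ((T ^^ (k - 1)) (\<Sum>i<l. scale (d i) (f i))) = 0"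
            using \<open>k > 0\<close> by (auto simp: K_def)
          then have "d l = 0"
            using arg_cong[OF sum, of "\<lambda>x. \<phi> ((T ^^ (k - 1)) x)"] pair[of "k - 1"] \<open>k > 0\<close>
            by (simp add: \<phi>_pow(1-3))
          moreover from this have "\<forall>i<l. d i = 0"
            using ind sum by (auto simp: independent_family_def)
          ultimately show "d i = 0"
            using i by (auto simp: less_Suc_eq)
        qed
        then have "Suc l \<le> Suc m"
          using f v by (intro Suc.prems(3)[rule_format, of "Suc l" "f(l := v)"]) (auto simp: K_def)
        then show ?thesis by simp
      qed
      then obtain \<beta> where \<beta>: "bilinear_form \<beta>" "nondegenerate_on K \<beta>" "selfadjoint_on K T \<beta>"
        using Suc.IH[OF K] T_K by blast
      have \<beta>_bilinear: "\<beta> (x + x') y = \<beta> x y + \<beta> x' y" "\<beta> (scale r x) y = r * \<beta> x y"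
        "\<beta> x (y + y') = \<beta> x y + \<beta> x y'" "\<beta> x (scale r y) = r * \<beta> x y" "\<beta> x 0 = 0" for x x' y y' r
        using \<beta>(1) functionalD(3)[of "\<beta> x"] by (auto simp: bilinear_form_def functional_iff)
      define q where "q x = x - p x" for x
      have q_linear: "q (x + y) = q x + q y" "q (scale r x) = scale r (q x)" for x y r
        by (simp_all add: q_def p_linear scale_right_diff_distrib)
      have q_T: "q (T x) = T (q x)" if "x \<in> U" for x
        using that by (simp add: q_def p_T T.diff)
      have "bilinear_form (\<lambda>x y. \<gamma> x y + \<beta> (q x) (q y))"
        by (simp add: bilinear_form_def functional_iff \<gamma>_bilinear \<beta>_bilinear q_linear algebra_simps)
      moreover have "selfadjoint_on U T (\<lambda>x y. \<gamma> x y + \<beta> (q x) (q y))"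
        using \<beta>(3) diff_K by (simp add: selfadjoint_on_def \<gamma>_selfadjoint q_T) (simp add: q_def)
      moreover have "nondegenerate_on U (\<lambda>x y. \<gamma> x y + \<beta> (q x) (q y))"
        unfolding nondegenerate_on_def
      proof (intro ballI impI)
        fix x assume x: "x \<in> U" and zero: "\<forall>y\<in>U. \<gamma> x y + \<beta> (q x) (q y) = 0"
        \<comment> \<open>Pairing with the chain vectors, on which \<open>q\<close> vanishes, forces
          \<open>x\<close> into \<open>K\<close>; there only \<open>\<beta>\<close> remains.\<close>
        have "\<phi> ((T ^^ b) x) = 0" if "b < k" for b
        proof -
          have "q ((T ^^ b) v) = 0"
            using that by (simp add: q_def p_id pow_W)
          then have "\<gamma> x ((T ^^ b) v) = 0"
            using zero pow_U[OF v, of b] by (auto simp: \<beta>_bilinear)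
          then show ?thesis
            using that by (simp add: \<gamma>_pow \<phi>_p)
        qed
        then have xK: "x \<in> K" using x by (simp add: K_def)
        have "\<beta> x y = 0" if "y \<in> K" for y
          using zero that \<gamma>_K[OF that, of x] xK by (auto simp: q_def p_K K_def)
        then show "x = 0"
          using \<beta>(2) xK by (auto simp: nondegenerate_on_def)
      qed
      ultimately show "\<exists>\<beta>. bilinear_form \<beta> \<and> nondegenerate_on U \<beta> \<and> selfadjoint_on U T \<beta>"
        by blast
    qed
  qed
qed

lemma (in vector_space) exists_selfadjoint_form:
  assumes "Vector_Spaces.linear scale scale T" "subspace U" "T ` U \<subseteq> U"
    and "finite C" "U \<subseteq> span C"
  shows "\<exists>\<beta>. bilinear_form \<beta> \<and> nondegenerate_on U \<beta> \<and> selfadjoint_on U T \<beta>"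
proof (rule exists_selfadjoint_form_aux[OF assms(1-3)])
  show "\<forall>k f. (\<forall>i<k. f i \<in> U) \<and> independent_family k f \<longrightarrow> k \<le> card C"
  proof (intro allI impI, elim conjE, rule ccontr)
    fix k f assume "\<forall>i<k. f i \<in> U" "independent_family k f" "\<not> k \<le> card C"
    then show False
      using family_dependent[of C k f] assms(4,5) by (auto simp: independent_family_def)
  qed
qed

section \<open>Symmetric forms with prescribed values\<close>

text \<open>The row \<open>g\<close> of the new vector \<open>p\<close> has its values on
  \<open>B\<close> dictated by symmetry and must be independent of the old rows on \<open>U\<close>.
  If a first candidate \<open>f\<close> depends on them, adding a functional that is zero on
  \<open>B\<close> and 1 at \<open>p\<close> repairs it.\<close>

lemma (in vector_space) exists_symmetric_extension_step:
  assumes "finite B" "independent B" "B \<subseteq> U" "subspace U" "p \<in> U" "p \<notin> span B"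
    and q: "\<And>b. b \<in> B \<Longrightarrow> functional (q b)"
    and sym: "\<And>b b'. b \<in> B \<Longrightarrow> b' \<in> B \<Longrightarrow> q b b' = q b' b"
  shows "\<exists>g. functional g \<and> (\<forall>b\<in>B. g b = q b p) \<and> (\<nexists>c. \<forall>u\<in>U. g u = (\<Sum>b\<in>B. c b * q b u))"
proof -
  have "p \<notin> B" using assms(6) span_base by blast
  have ind: "independent (insert p B)"
    using assms(2,6) by (simp add: independent_insert)
  obtain f where f: "functional f" "\<And>b. b \<in> B \<Longrightarrow> f b = q b p"
    using functional_extend[OF assms(2), of "\<lambda>b. q b p"] by blast
  show ?thesis
  proof (cases "\<exists>c. \<forall>u\<in>U. f u = (\<Sum>b\<in>B. c b * q b u)")
    case False
    then show ?thesis using f by blast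
  next
    case True
    then obtain c where c: "\<And>u. u \<in> U \<Longrightarrow> f u = (\<Sum>b\<in>B. c b * q b u)" by blast
    obtain h where h: "functional h" "\<And>b. b \<in> B \<Longrightarrow> h b = 0" "h p = 1"
      using functional_extend[OF ind, of "\<lambda>b. if b = p then 1 else 0"] \<open>p \<notin> B\<close> by force
    \<comment> \<open>By symmetry of the prescribed values, all old rows vanish at \<open>z\<close>,
      hence so does \<open>f\<close>. As \<open>h z = 1\<close>, the row \<open>f + h\<close> cannot
      be a combination of the old ones.\<close>
    define z where "z = p - (\<Sum>b\<in>B. scale (c b) b)"
    have "z \<in> U"
      unfolding z_def using assms(3,4,5)
      by (intro subspace_diff subspace_sum subspace_scale) auto
    have qz: "q b z = 0" if b: "b \<in> B" for b
    proof -
      have "q b z = f b - (\<Sum>b'\<in>B. c b' * q b b')"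
        using f(2)[OF b] by (simp add: z_def functionalD[OF q[OF b]])
      also have "(\<Sum>b'\<in>B. c b' * q b b') = f b"
        using c[of b] b assms(3) sym[OF b] by (auto intro!: sum.cong)
      finally show ?thesis by simp
    qed
    have hz: "h z = 1"
      using h by (simp add: z_def functionalD[OF h(1)])
    have "\<nexists>d. \<forall>u\<in>U. f u + h u = (\<Sum>b\<in>B. d b * q b u)"
    proof
      assume "\<exists>d. \<forall>u\<in>U. f u + h u = (\<Sum>b\<in>B. d b * q b u)"
      then obtain d where "f z + h z = (\<Sum>b\<in>B. d b * q b z)"
        using \<open>z \<in> U\<close> by blast
      then show False
        using c[OF \<open>z \<in> U\<close>] by (simp add: qz hz)
    qed
    moreover have "functional (\<lambda>u. f u + h u)"
      using f(1) h(1) by (simp add: functional_iff algebra_simps)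
    ultimately show ?thesis
      using f(2) h(2) by (intro exI[of _ "\<lambda>u. f u + h u"]) simp
  qed
qed

text \<open>\<open>q b\<close> is the row prescribed for \<open>b\<close>. Rows are added one at a
  time, keeping them symmetric and independent on \<open>U\<close>, until \<open>B\<close> spans
  \<open>U\<close>; independence of all rows is then nondegeneracy.\<close>

lemma (in vector_space) exists_symmetric_extension:
  assumes "finite B" "independent B" "B \<subseteq> U" "subspace U" "finite C" "U \<subseteq> span C"
    and "\<And>b. b \<in> B \<Longrightarrow> functional (q b)"
    and "\<And>b b'. b \<in> B \<Longrightarrow> b' \<in> B \<Longrightarrow> q b b' = q b' b"
    and "\<And>c. (\<forall>u\<in>U. (\<Sum>b\<in>B. c b * q b u) = 0) \<Longrightarrow> \<forall>b\<in>B. c b = 0"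
  shows "\<exists>\<beta>. bilinear_form \<beta> \<and> nondegenerate_on U \<beta> \<and> (\<forall>x\<in>U. \<forall>y\<in>U. \<beta> x y = \<beta> y x) \<and>
    (\<forall>b\<in>B. \<beta> b = q b)"
  using assms
proof (induction "card C - card B" arbitrary: B q rule: less_induct)
  case less
  note q = less.prems(7) and sym = less.prems(8) and indep = less.prems(9)
  show ?case
  proof (cases "U \<subseteq> span B")
    case False
    then obtain p where p: "p \<in> U" "p \<notin> span B" by blast
    then have "p \<notin> B" using span_base by blast
    have ind: "independent (insert p B)"
      using less.prems(2) p by (simp add: independent_insert)
    obtain g where g: "functional g" "\<And>b. b \<in> B \<Longrightarrow> g b = q b p"
      "\<nexists>c. \<forall>u\<in>U. g u = (\<Sum>b\<in>B. c b * q b u)"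
      using exists_symmetric_extension_step[OF less.prems(1-4) p q sym] by blast
    define q' where "q' = q(p := g)"
    have q': "q' p = g" "\<And>b. b \<in> B \<Longrightarrow> q' b = q b"
      using \<open>p \<notin> B\<close> by (auto simp: q'_def)
    \<comment> \<open>The measure is a truncated difference; this bound ensures that it really
      decreases.\<close>
    have "card (insert p B) \<le> card C"
      using independent_span_bound[OF \<open>finite C\<close> ind] less.prems p by auto
    then have card: "card C - card (insert p B) < card C - card B"
      using \<open>p \<notin> B\<close> \<open>finite B\<close> by simp
    have indep': "\<forall>b\<in>insert p B. c b = 0"
      if zero: "\<forall>u\<in>U. (\<Sum>b\<in>insert p B. c b * q' b u) = 0" for c
    proof -
      have *: "c p * g u + (\<Sum>b\<in>B. c b * q b u) = 0" if "u \<in> U" for u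
        using zero[rule_format, OF that] \<open>p \<notin> B\<close> \<open>finite B\<close> by (simp add: q' cong: sum.cong)
      have "c p = 0"
      proof (rule ccontr)
        assume "c p \<noteq> 0"
        have "g u = (\<Sum>b\<in>B. (- c b / c p) * q b u)" if "u \<in> U" for u
        proof -
          have "c p * g u = - (\<Sum>b\<in>B. c b * q b u)"
            using *[OF that] by (simp add: eq_neg_iff_add_eq_0)
          then have "g u = - (\<Sum>b\<in>B. c b * q b u) / c p"
            using \<open>c p \<noteq> 0\<close> by (simp add: field_simps)
          then show ?thesis
            by (simp add: sum_divide_distrib sum_negf)
        qed
        then have "\<exists>c. \<forall>u\<in>U. g u = (\<Sum>b\<in>B. c b * q b u)"
          by (intro exI[of _ "\<lambda>b. - c b / c p"]) simp
        with g(3) show False by contradiction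
      qed
      then show ?thesis
        using indep[of c] * by simp
    qed
    have "\<exists>\<beta>. bilinear_form \<beta> \<and> nondegenerate_on U \<beta> \<and> (\<forall>x\<in>U. \<forall>y\<in>U. \<beta> x y = \<beta> y x) \<and>
      (\<forall>b\<in>insert p B. \<beta> b = q' b)"
    proof (rule less.hyps[OF card _ ind _ \<open>subspace U\<close> \<open>finite C\<close> \<open>U \<subseteq> span C\<close> _ _ indep'])
      show "finite (insert p B)" "insert p B \<subseteq> U"
        using less.prems(1,3) p by auto
      show "functional (q' b)" if "b \<in> insert p B" for b
        using that q g(1) q' by auto
      show "q' b b' = q' b' b" if "b \<in> insert p B" "b' \<in> insert p B" for b b'
        using that sym g(2) q' by auto
    qed
    then obtain \<beta> where "bilinear_form \<beta>" "nondegenerate_on U \<beta>" "\<forall>x\<in>U. \<forall>y\<in>U. \<beta> x y = \<beta> y x"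
      "\<forall>b\<in>insert p B. \<beta> b = q' b" by blast
    then show ?thesis
      using q'(2) by (intro exI[of _ \<beta>]) auto
  next
    case True
    \<comment> \<open>\<open>B\<close> spans only \<open>U\<close>, so coordinates are taken in a
      basis of the ambient space that contains \<open>B\<close>; this makes them linear
      everywhere.\<close>
    define r where "r b x = representation (extend_basis B) x b" for b x
    have r: "functional (r b)" for b
      unfolding r_def
      by (rule linear_representation) (use less.prems(2) in \<open>auto simp: independent_extend_basis\<close>)
    have r_B: "r b b' = (if b = b' then 1 else 0)" if "b' \<in> B" for b b'
      using that extend_basis_superset[OF less.prems(2)] representation_basis[OF independent_extend_basis[OF less.prems(2)]]
      by (auto simp: r_def)
    have x_eq: "x = (\<Sum>b\<in>B. scale (r b x) b)" if "x \<in> U" for x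
    proof -
      obtain a where a: "x = (\<Sum>b\<in>B. scale (a b) b)"
        using \<open>x \<in> U\<close> True span_finite[OF \<open>finite B\<close>] by auto
      have "r b x = a b" if "b \<in> B" for b
      proof -
        have "r b x = (\<Sum>b'\<in>B. if b' = b then a b else 0)"
          unfolding a functionalD[OF r] using r_B by (intro sum.cong) auto
        then show ?thesis using that \<open>finite B\<close> by simp
      qed
      then show ?thesis using a by simp
    qed
    define \<beta> where "\<beta> x y = (\<Sum>b\<in>B. r b x * q b y)" for x y
    have "bilinear_form \<beta>"
      unfolding bilinear_form_def functional_iff \<beta>_def
      by (simp add: functionalD[OF r] functionalD[OF q] sum.distrib sum_distrib_left algebra_simps cong: sum.cong)
    moreover have "\<beta> x y = \<beta> y x" if "x \<in> U" "y \<in> U" for x y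
    proof -
      have exp: "\<beta> x y = (\<Sum>b\<in>B. \<Sum>b'\<in>B. r b x * r b' y * q b b')" if "y \<in> U" for x y
      proof -
        have "q b y = (\<Sum>b'\<in>B. r b' y * q b b')" if "b \<in> B" for b
          by (subst x_eq[OF \<open>y \<in> U\<close>]) (simp add: functionalD[OF q[OF that]])
        then show ?thesis
          by (simp add: \<beta>_def sum_distrib_left mult.assoc cong: sum.cong)
      qed
      show ?thesis
        unfolding exp[OF that(1)] exp[OF that(2)]
        by (subst sum.swap) (auto intro!: sum.cong simp: sym mult.commute)
    qed
    moreover have "nondegenerate_on U \<beta>"
      unfolding nondegenerate_on_def
    proof (intro ballI impI)
      fix x assume x: "x \<in> U" and "\<forall>y\<in>U. \<beta> x y = 0"
      then have "\<forall>b\<in>B. r b x = 0"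
        using indep[of "\<lambda>b. r b x"] by (simp add: \<beta>_def)
      then show "x = 0"
        by (subst x_eq[OF x]) simp
    qed
    moreover have "\<beta> b = q b" if "b \<in> B" for b
    proof
      fix y
      have "\<beta> b y = (\<Sum>b'\<in>B. if b' = b then q b y else 0)"
        unfolding \<beta>_def using r_B[OF that] by (intro sum.cong) auto
      then show "\<beta> b y = q b y" using that \<open>finite B\<close> by simp
    qed
    ultimately show ?thesis by blast
  qed
qed

section \<open>Double cosets in the general linear group\<close>

text \<open>Column vectors of length \<open>N\<close> are represented by functions vanishing from \<open>N\<close> on, because the
  type-based vector space locale cannot be instantiated with carrier sets of vectors.\<close>

definition fscale :: "'q::field \<Rightarrow> (nat \<Rightarrow> 'q) \<Rightarrow> nat \<Rightarrow> 'q" where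
  "fscale c x = (\<lambda>i. c * x i)"

definition fvec :: "nat \<Rightarrow> (nat \<Rightarrow> 'q::field) set" where
  "fvec N = {x. \<forall>i\<ge>N. x i = 0}"

definition fbasis :: "nat \<Rightarrow> nat \<Rightarrow> 'q::field" where
  "fbasis j = (\<lambda>i. if i = j then 1 else 0)"

interpretation fn: vector_space "fscale :: 'q::field \<Rightarrow> _"
  by unfold_locales (auto simp: fscale_def fun_eq_iff algebra_simps)

lemma fscale_apply [simp]: "fscale c x i = c * x i"
  by (simp add: fscale_def)

lemma fsum_apply: "(sum f A :: nat \<Rightarrow> 'q::field) i = (\<Sum>a\<in>A. f a i)"
  by (induction A rule: infinite_finite_induct) auto

lemma subspace_fvec: "fn.subspace (fvec N)"
  by (auto simp: fn.subspace_def fvec_def)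

lemma fbasis_fvec: "j < N \<Longrightarrow> fbasis j \<in> fvec N"
  by (auto simp: fvec_def fbasis_def)

lemma fvec_expand:
  assumes "x \<in> fvec N"
  shows "x = (\<Sum>j<N. fscale (x j) (fbasis j))"
proof
  fix i
  have "(\<Sum>j<N. x j * fbasis j i) = (\<Sum>j<N. if j = i then x i else 0)"
    by (intro sum.cong) (auto simp: fbasis_def)
  then show "x i = (\<Sum>j<N. fscale (x j) (fbasis j)) i"
    using assms by (auto simp: fsum_apply fvec_def)
qed

lemma fvec_span: "fvec N \<subseteq> fn.span (fbasis ` {..<N})"
proof
  fix x :: "nat \<Rightarrow> 'a" assume "x \<in> fvec N"
  then show "x \<in> fn.span (fbasis ` {..<N})"
    by (subst fvec_expand, assumption) (intro fn.span_sum fn.span_scale fn.span_base, auto)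
qed

lemma functional_fvec:
  assumes "fn.functional \<phi>" "x \<in> fvec N"
  shows "\<phi> x = (\<Sum>j<N. x j * \<phi> (fbasis j))"
  by (subst fvec_expand[OF assms(2)]) (simp add: fn.functionalD[OF assms(1)])

section \<open>Gram matrices and invertible matrices\<close>

definition gram_mat :: "nat \<Rightarrow> ((nat \<Rightarrow> 'q::field) \<Rightarrow> (nat \<Rightarrow> 'q) \<Rightarrow> 'q) \<Rightarrow> 'q mat" where
  "gram_mat N \<beta> = mat N N (\<lambda>(i, j). \<beta> (fbasis i) (fbasis j))"

lemma gram_mat_carrier [simp]: "gram_mat N \<beta> \<in> carrier_mat N N"
  by (simp add: gram_mat_def)

lemma gram_mat_index: "i < N \<Longrightarrow> j < N \<Longrightarrow> gram_mat N \<beta> $$ (i, j) = \<beta> (fbasis i) (fbasis j)"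
  by (simp add: gram_mat_def)

lemma GL_iff:
  "(A :: 'q::field mat) \<in> carrier (general_linear_group n) \<longleftrightarrow> A \<in> carrier_mat n n \<and> det A \<noteq> 0"
proof -
  have "A \<in> Units (ring_mat TYPE('q) n ()) \<longleftrightarrow> A \<in> carrier_mat n n \<and> det A \<noteq> 0"
    using det_non_zero_imp_unit[of A n] unit_imp_det_non_zero[of A n "()"]
    by (auto simp: Units_def ring_mat_def)
  then show ?thesis
    by (simp add: general_linear_group_def units_of_carrier)
qed

lemma GL_carrier_mat: "A \<in> carrier (general_linear_group n) \<Longrightarrow> A \<in> carrier_mat n n"
  by (simp add: GL_iff)

lemma GL_mult: "A \<otimes>\<^bsub>general_linear_group n\<^esub> B = A * B"
  and GL_one: "\<one>\<^bsub>general_linear_group n\<^esub> = 1\<^sub>m n"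
  by (simp_all add: general_linear_group_def units_of_def ring_mat_def)

lemma addrow_mat_GL:
  "k < n \<Longrightarrow> l < n \<Longrightarrow> k \<noteq> l \<Longrightarrow> addrow_mat n a k l \<in> carrier (general_linear_group n)"
  by (simp add: general_linear_group_def units_of_carrier addrow_mat_Unit)

lemma GL_inverse:
  assumes "(A :: 'q::field mat) \<in> carrier (general_linear_group n)"
  obtains A' where "A' \<in> carrier (general_linear_group n)" "A' \<in> carrier_mat n n"
    "A * A' = 1\<^sub>m n" "A' * A = 1\<^sub>m n" "A' = inv\<^bsub>general_linear_group n\<^esub> A"
proof -
  interpret group "general_linear_group n :: 'q mat monoid"
    by (rule group_general_linear_group)
  show thesis
    using that[of "inv\<^bsub>general_linear_group n\<^esub> A"] assms r_inv[OF assms] l_inv[OF assms]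
    by (simp add: GL_mult GL_one GL_carrier_mat)
qed

lemma GL_transpose: "A \<in> carrier (general_linear_group n) \<Longrightarrow> A\<^sup>T \<in> carrier (general_linear_group n)"
  by (auto simp: GL_iff det_transpose)

text \<open>A kernel vector of the transposed Gram matrix lies in the left radical of the form,
  which is the radical excluded by \<open>nondegenerate_on\<close>.\<close>

lemma gram_mat_GL:
  assumes "fn.bilinear_form \<beta>" "fn.nondegenerate_on (fvec N) \<beta>"
  shows "gram_mat N \<beta> \<in> carrier (general_linear_group N)"
proof (rule ccontr)
  assume "\<not> ?thesis"
  then have "det (gram_mat N \<beta>) = 0"
    by (simp add: GL_iff)
  then have "det (gram_mat N \<beta>)\<^sup>T = 0"
    using det_transpose[of "gram_mat N \<beta>" N] by simp
  then obtain v where v: "v \<in> carrier_vec N" "v \<noteq> 0\<^sub>v N" "(gram_mat N \<beta>)\<^sup>T *\<^sub>v v = 0\<^sub>v N"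
    using det_0_iff_vec_prod_zero_field[of "(gram_mat N \<beta>)\<^sup>T" N] by auto
  define x where "x i = (if i < N then v $ i else 0)" for i
  have x: "x \<in> fvec N" by (simp add: x_def fvec_def)
  have functional: "fn.functional (\<beta> x)" "fn.functional (\<lambda>x. \<beta> x y)" for x y
    using assms(1) by (auto simp: fn.bilinear_form_def)
  have "\<beta> x (fbasis j) = 0" if j: "j < N" for j
  proof -
    have "\<beta> x (fbasis j) = (\<Sum>i<N. x i * \<beta> (fbasis i) (fbasis j))"
      by (rule functional_fvec[OF functional(2) x])
    also have "\<dots> = ((gram_mat N \<beta>)\<^sup>T *\<^sub>v v) $ j"
      using j v(1) by (auto simp: scalar_prod_def gram_mat_def x_def lessThan_atLeast0 mult.commute intro!: sum.cong)
    finally show ?thesis using v(3) j by simp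
  qed
  then have "\<beta> x y = 0" if "y \<in> fvec N" for y
    by (subst functional_fvec[OF functional(1) that]) simp
  then have "x = 0"
    using assms(2) x by (auto simp: fn.nondegenerate_on_def)
  have "v = 0\<^sub>v N"
  proof (rule eq_vecI)
    fix i assume "i < dim_vec (0\<^sub>v N :: 'a vec)"
    then show "v $ i = 0\<^sub>v N $ i"
      using fun_cong[OF \<open>x = 0\<close>, of i] by (simp add: x_def)
  qed (use v in auto)
  then show False using v by simp
qed

text \<open>For the Gram matrix \<open>S\<close> of a form, \<open>A\<^sup>T * S = S * A\<close>
  says that \<open>A\<close> is self-adjoint for the form, and nondegeneracy makes \<open>S\<close>
  invertible.\<close>

lemma transpose_conjugate:
  assumes A: "(A :: 'q::field mat) \<in> carrier_mat N N"
  shows "\<exists>S\<in>carrier (general_linear_group N). A\<^sup>T * S = S * A"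
proof -
  define T where "T x = (\<lambda>i. if i < N then \<Sum>j<N. A $$ (i, j) * x j else 0)" for x :: "nat \<Rightarrow> 'q"
  have lin: "Vector_Spaces.linear fscale fscale T"
    by (auto simp: Vector_Spaces.linear_iff fn.vector_space_axioms T_def fun_eq_iff
        sum.distrib sum_distrib_left algebra_simps)
  have "T ` fvec N \<subseteq> fvec N"
    by (auto simp: T_def fvec_def)
  from fn.exists_selfadjoint_form[OF lin subspace_fvec this _ fvec_span]
  obtain \<beta> where \<beta>: "fn.bilinear_form \<beta>" "fn.nondegenerate_on (fvec N) \<beta>" "fn.selfadjoint_on (fvec N) T \<beta>"
    by auto
  have functional: "fn.functional (\<beta> x)" "fn.functional (\<lambda>x. \<beta> x y)" for x y
    using \<beta>(1) by (auto simp: fn.bilinear_form_def)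
  have T_fvec: "T x \<in> fvec N" for x by (simp add: T_def fvec_def)
  have T_basis: "T (fbasis i) l = A $$ (l, i)" if "i < N" "l < N" for i l
  proof -
    have "(\<Sum>j<N. A $$ (l, j) * fbasis i j) = (\<Sum>j<N. if j = i then A $$ (l, i) else 0)"
      by (intro sum.cong) (auto simp: fbasis_def)
    then show ?thesis using that by (simp add: T_def)
  qed
  have "A\<^sup>T * gram_mat N \<beta> = gram_mat N \<beta> * A"
  proof (rule eq_matI)
    fix i j assume "i < dim_row (gram_mat N \<beta> * A)" "j < dim_col (gram_mat N \<beta> * A)"
    then have ij: "i < N" "j < N" using A by (auto simp: gram_mat_def)
    have "(A\<^sup>T * gram_mat N \<beta>) $$ (i, j) = (\<Sum>l<N. T (fbasis i) l * \<beta> (fbasis l) (fbasis j))"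
      using ij A by (auto simp: scalar_prod_def gram_mat_def lessThan_atLeast0 T_basis intro!: sum.cong)
    also have "\<dots> = \<beta> (T (fbasis i)) (fbasis j)"
      by (rule functional_fvec[OF functional(2) T_fvec, symmetric])
    also have "\<dots> = \<beta> (fbasis i) (T (fbasis j))"
      using \<beta>(3) ij by (auto simp: fn.selfadjoint_on_def fbasis_fvec)
    also have "\<dots> = (\<Sum>l<N. T (fbasis j) l * \<beta> (fbasis i) (fbasis l))"
      by (rule functional_fvec[OF functional(1) T_fvec])
    also have "\<dots> = (gram_mat N \<beta> * A) $$ (i, j)"
      using ij A by (auto simp: scalar_prod_def gram_mat_def lessThan_atLeast0 T_basis mult.commute intro!: sum.cong)
    finally show "(A\<^sup>T * gram_mat N \<beta>) $$ (i, j) = (gram_mat N \<beta> * A) $$ (i, j)" .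
  qed (use A in \<open>auto simp: gram_mat_def\<close>)
  then show ?thesis
    using gram_mat_GL[OF \<beta>(1,2)] by blast
qed

text \<open>Transitivity on nonzero vectors. The Gram matrix of a symmetric form with first row
  \<open>b\<close> has first column \<open>b\<close> as well.\<close>

lemma exists_symmetric_first_column:
  assumes "0 < n" "b \<in> fvec n" "b \<noteq> 0"
  shows "\<exists>P\<in>carrier (general_linear_group n). \<forall>i<n. P $$ (i, 0) = (b i :: 'q::field)"
proof -
  define q where "q x = (\<Sum>j<n. b j * x j)" for x
  have q_basis: "q (fbasis j) = b j" if "j < n" for j
  proof -
    have "q (fbasis j) = (\<Sum>i<n. if i = j then b j else 0)"
      unfolding q_def by (intro sum.cong) (auto simp: fbasis_def)
    then show ?thesis using that by simp
  qed
  obtain j where j: "j < n" "b j \<noteq> 0"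
    using assms by (auto simp: fvec_def fun_eq_iff) (metis not_le)
  have "\<exists>\<beta>. fn.bilinear_form \<beta> \<and> fn.nondegenerate_on (fvec n) \<beta> \<and>
      (\<forall>x\<in>fvec n. \<forall>y\<in>fvec n. \<beta> x y = \<beta> y x) \<and> (\<forall>e\<in>{fbasis 0}. \<beta> e = q)"
  proof (rule fn.exists_symmetric_extension[OF _ _ _ subspace_fvec _ fvec_span])
    show "fn.independent {fbasis 0 :: nat \<Rightarrow> 'q}"
      by (auto simp: fbasis_def fun_eq_iff)
    show "fn.functional q"
      by (auto simp: fn.functional_iff q_def sum.distrib sum_distrib_left algebra_simps)
    show "\<forall>e\<in>{fbasis 0 :: nat \<Rightarrow> 'q}. c e = 0" if "\<forall>u\<in>fvec n. (\<Sum>e\<in>{fbasis 0}. c e * q u) = 0" for c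
      using that[rule_format, OF fbasis_fvec[OF j(1)]] j by (simp add: q_basis)
  qed (use assms in \<open>auto simp: fbasis_fvec\<close>)
  then obtain \<beta> where \<beta>: "fn.bilinear_form \<beta>" "fn.nondegenerate_on (fvec n) \<beta>"
    "\<And>x y. x \<in> fvec n \<Longrightarrow> y \<in> fvec n \<Longrightarrow> \<beta> x y = \<beta> y x" "\<beta> (fbasis 0) = q"
    by auto
  have "gram_mat n \<beta> $$ (i, 0) = b i" if "i < n" for i
    using that assms(1) \<beta>(3)[of "fbasis i" "fbasis 0"] by (simp add: gram_mat_index fbasis_fvec \<beta>(4) q_basis)
  then show ?thesis
    using gram_mat_GL[OF \<beta>(1,2)] by blast
qed

section \<open>The embedded smaller general linear group\<close>

lemma corner_embedding_GL:
  assumes "(B :: 'q::field mat) \<in> carrier (general_linear_group n)"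
  shows "corner_embedding n B \<in> carrier (general_linear_group (n + 1))"
proof -
  have "det (corner_embedding n B) = det B * det (1\<^sub>m 1)"
    unfolding corner_embedding_def using assms
    by (intro det_four_block_mat_upper_right_zero) (auto simp: GL_iff)
  then show ?thesis
    using assms by (auto simp: GL_iff corner_embedding_def)
qed

lemma corner_embedding_transpose:
  assumes "(B :: 'q::field mat) \<in> carrier_mat n n"
  shows "(corner_embedding n B)\<^sup>T = corner_embedding n B\<^sup>T"
  by (rule eq_matI) (use assms in \<open>auto simp: corner_embedding_def\<close>)

lemma corner_embedding_image:
  assumes k: "(k :: 'q::field mat) \<in> carrier (general_linear_group (n + 1))"
    and col: "\<And>i. i < n + 1 \<Longrightarrow> k $$ (i, n) = (if i = n then 1 else 0)"
    and row: "\<And>j. j < n + 1 \<Longrightarrow> k $$ (n, j) = (if j = n then 1 else 0)"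
  shows "k \<in> corner_embedding n ` carrier (general_linear_group n)"
proof -
  define B where "B = mat n n (\<lambda>(i, j). k $$ (i, j))"
  have kc: "k \<in> carrier_mat (n + 1) (n + 1)" using k by (rule GL_carrier_mat)
  have eq: "k = corner_embedding n B"
  proof (rule eq_matI)
    fix i j assume "i < dim_row (corner_embedding n B)" "j < dim_col (corner_embedding n B)"
    then have "i < n + 1" "j < n + 1" by (auto simp: corner_embedding_def B_def)
    then show "k $$ (i, j) = corner_embedding n B $$ (i, j)"
      using col[of i] row[of j]
      by (cases "i = n"; cases "j = n") (auto simp: corner_embedding_def B_def)
  qed (use kc in \<open>auto simp: corner_embedding_def B_def\<close>)
  have "det k = det B * det (1\<^sub>m 1)"
    unfolding eq corner_embedding_def
    by (intro det_four_block_mat_upper_right_zero) (auto simp: B_def)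
  then have "B \<in> carrier (general_linear_group n)"
    using k by (auto simp: GL_iff B_def)
  then show ?thesis using eq by blast
qed


lemma GL_mult_closed:
  assumes "(A :: 'q::field mat) \<in> carrier (general_linear_group n)" "B \<in> carrier (general_linear_group n)"
  shows "A * B \<in> carrier (general_linear_group n)"
  using monoid.m_closed[OF group.is_monoid[OF group_general_linear_group] assms]
  by (simp add: GL_mult)

lemma mat_mult_index:
  assumes "A \<in> carrier_mat n n" "B \<in> carrier_mat n n" "i < n" "j < n"
  shows "(A * B) $$ (i, j) = (\<Sum>l<n. A $$ (i, l) * B $$ (l, j))"
  using assms by (auto simp: scalar_prod_def lessThan_atLeast0)

abbreviation corner_group :: "nat \<Rightarrow> 'q::field mat set" where
  "corner_group n \<equiv> corner_embedding n ` carrier (general_linear_group n)"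

lemma corner_group_GL: "h \<in> corner_group n \<Longrightarrow> h \<in> carrier (general_linear_group (n + 1))"
  using corner_embedding_GL by auto

lemma corner_group_transpose: "h \<in> corner_group n \<Longrightarrow> h\<^sup>T \<in> corner_group n"
  by (auto simp: corner_embedding_transpose GL_carrier_mat intro!: imageI GL_transpose)

lemma corner_group_index:
  assumes "(h :: 'q::field mat) \<in> corner_group n" "i < n + 1"
  shows "h $$ (i, n) = (if i = n then 1 else 0)" "h $$ (n, i) = (if i = n then 1 else 0)"
  using assms by (auto simp: corner_embedding_def dest!: GL_carrier_mat)

lemma corner_group_inverse:
  assumes h: "(h :: 'q::field mat) \<in> corner_group n" and h': "h' \<in> carrier_mat (n + 1) (n + 1)"
    and inv: "h * h' = 1\<^sub>m (n + 1)" "h' * h = 1\<^sub>m (n + 1)"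
  shows "h' \<in> corner_group n"
proof (rule corner_embedding_image)
  have hc: "h \<in> carrier_mat (n + 1) (n + 1)"
    using corner_group_GL[OF h] by (rule GL_carrier_mat)
  have "det h' * det h = 1"
    using det_mult[OF h' hc] inv by simp
  then show "h' \<in> carrier (general_linear_group (n + 1))"
    using h' by (auto simp: GL_iff)
  fix i assume i: "i < n + 1"
  have "(\<Sum>l<n+1. h' $$ (i, l) * (if l = n then 1 else 0)) = (if i = n then 1 else 0)"
    using mat_mult_index[OF h' hc i, of n] corner_group_index(1)[OF h] i by (simp add: inv)
  then show "h' $$ (i, n) = (if i = n then 1 else 0)"
    by (simp add: if_distrib cong: if_cong)
  have "(\<Sum>l<n+1. (if l = n then 1 else 0) * h' $$ (l, i)) = (if i = n then 1 else 0)"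
    using mat_mult_index[OF hc h' _ i, of n] corner_group_index(2)[OF h] i by (auto simp add: inv)
  then show "h' $$ (n, i) = (if i = n then 1 else 0)"
    by (simp add: if_distrib[of "\<lambda>x. x * _"] cong: if_cong)
qed

text \<open>A symmetric matrix \<open>S\<close> sending the last basis vector and the last column of \<open>g\<close> to the
  last row of \<open>g\<^sup>-\<^sup>1\<close> and the last basis covector makes \<open>k = S g\<close> an element of the corner
  group with \<open>g\<^sup>T = k\<^sup>T g k\<^sup>-\<^sup>1\<close>.\<close>

lemma transpose_in_double_coset:
  fixes g :: "'q::field mat"
  assumes g: "g \<in> carrier (general_linear_group (n + 1))"
    and iff: "(\<exists>i<n. g $$ (i, n) \<noteq> 0) \<longleftrightarrow> (\<exists>j<n. g $$ (n, j) \<noteq> 0)"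
  shows "\<exists>h\<in>corner_group n. \<exists>k\<in>corner_group n. g\<^sup>T = h * g * k"
proof -
  let ?N = "n + 1"
  let ?U = "fvec ?N :: (nat \<Rightarrow> 'q) set"
  have gc: "g \<in> carrier_mat ?N ?N" using g by (rule GL_carrier_mat)
  obtain g' where g': "g' \<in> carrier_mat ?N ?N" "g * g' = 1\<^sub>m ?N" "g' * g = 1\<^sub>m ?N"
    by (rule GL_inverse[OF g])
  define v where "v i = (if i < ?N then g $$ (i, n) else 0)" for i
  define \<phi> where "\<phi> x = x n" for x :: "nat \<Rightarrow> 'q"
  define \<psi> where "\<psi> x = (\<Sum>j<?N. g' $$ (n, j) * x j)" for x
  let ?e = "fbasis n :: nat \<Rightarrow> 'q"
  have lin: "fn.functional \<phi>" "fn.functional \<psi>"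
    by (auto simp: fn.functional_iff \<phi>_def \<psi>_def sum.distrib sum_distrib_left algebra_simps)
  have mem: "?e \<in> ?U" "v \<in> ?U"
    by (auto simp: fbasis_def v_def fvec_def)
  have \<psi>_basis: "\<psi> (fbasis j) = g' $$ (n, j)" if "j < ?N" for j
  proof -
    have "\<psi> (fbasis j) = (\<Sum>i<?N. if i = j then g' $$ (n, j) else 0)"
      unfolding \<psi>_def by (intro sum.cong) (auto simp: fbasis_def)
    then show ?thesis using that by simp
  qed
  have \<phi>_basis: "\<phi> (fbasis j) = (if j = n then 1 else 0)" for j
    by (auto simp: \<phi>_def fbasis_def)
  have \<psi>_col: "(\<Sum>l<?N. g' $$ (n, l) * g $$ (l, j)) = (if j = n then 1 else 0)" if "j < ?N" for j
    using mat_mult_index[OF g'(1) gc, of n j] that by (auto simp: g')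
  have "\<psi> v = (\<Sum>l<?N. g' $$ (n, l) * g $$ (l, n))"
    unfolding \<psi>_def v_def by (intro sum.cong) auto
  then have \<psi>_v: "\<psi> v = 1"
    using \<psi>_col[of n] by simp
  have \<phi>_v: "\<phi> v = g $$ (n, n)" by (simp add: \<phi>_def v_def)
  \<comment> \<open>The two prescribed rows are compatible since \<open>\<psi> v = 1\<close> and
    \<open>\<phi>\<close> is 1 at the last basis vector. The last basis vector and \<open>v\<close>
    are independent iff the last column of \<open>g\<close> is nonzero off the diagonal, and
    \<open>\<phi>\<close> and \<open>\<psi>\<close> are independent iff the last row is. By
    \<open>iff\<close> both happen together; otherwise the second requirement is a multiple of the
    first.\<close>
  have "\<exists>\<beta>. fn.bilinear_form \<beta> \<and> fn.nondegenerate_on ?U \<beta> \<and>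
    (\<forall>x\<in>?U. \<forall>y\<in>?U. \<beta> x y = \<beta> y x) \<and> (\<forall>u\<in>?U. \<beta> ?e u = \<psi> u \<and> \<beta> v u = \<phi> u)"
  proof (cases "\<exists>i<n. g $$ (i, n) \<noteq> 0")
    case True
    then obtain i j where i: "i < n" "g $$ (i, n) \<noteq> 0" and j: "j < n" "g $$ (n, j) \<noteq> 0"
      using iff by blast
    have "v \<noteq> ?e"
      using i by (auto simp: v_def fbasis_def fun_eq_iff intro!: exI[of _ i])
    have g'_row: "\<exists>l<n. g' $$ (n, l) \<noteq> 0"
    proof (rule ccontr)
      assume "\<not> ?thesis"
      then have zero: "g' $$ (n, l) = 0" if "l < n" for l using that by blast
      have "g' $$ (n, n) * g $$ (n, j) = 0" "g' $$ (n, n) * g $$ (n, n) = 1"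
        using \<psi>_col[of j] \<psi>_col[of n] j by (simp_all add: zero)
      then show False using j by auto
    qed
    define q where "q x = (if x = ?e then \<psi> else \<phi>)" for x
    have q: "q ?e = \<psi>" "q v = \<phi>" using \<open>v \<noteq> ?e\<close> by (auto simp: q_def)
    have "\<exists>\<beta>. fn.bilinear_form \<beta> \<and> fn.nondegenerate_on ?U \<beta> \<and>
      (\<forall>x\<in>?U. \<forall>y\<in>?U. \<beta> x y = \<beta> y x) \<and> (\<forall>b\<in>{v, ?e}. \<beta> b = q b)"
    proof (rule fn.exists_symmetric_extension[OF _ _ _ subspace_fvec _ fvec_span])
      have "v \<notin> fn.span {?e}"
      proof
        assume "v \<in> fn.span {?e}"
        then obtain c where "v = fscale c ?e" by (auto simp: fn.span_singleton)
        then have "v i = c * ?e i" by simp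
        then show False using i by (simp add: v_def fbasis_def)
      qed
      moreover have "?e \<noteq> 0" by (auto simp: fbasis_def fun_eq_iff)
      ultimately show "fn.independent {v, ?e}"
        using \<open>v \<noteq> ?e\<close> by (simp add: fn.independent_insert)
      show "fn.functional (q b)" if "b \<in> {v, ?e}" for b
        using that lin q by auto
      show "q b b' = q b' b" if "b \<in> {v, ?e}" "b' \<in> {v, ?e}" for b b'
        using that q \<psi>_v \<phi>_basis[of n] by auto
      show "\<forall>b\<in>{v, ?e}. c b = 0" if "\<forall>u\<in>?U. (\<Sum>b\<in>{v, ?e}. c b * q b u) = 0" for c
      proof -
        have *: "c v * \<phi> u + c ?e * \<psi> u = 0" if "u \<in> ?U" for u
          using \<open>\<forall>u\<in>?U. (\<Sum>b\<in>{v, ?e}. c b * q b u) = 0\<close> that \<open>v \<noteq> ?e\<close> q by simp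
        obtain l where l: "l < n" "g' $$ (n, l) \<noteq> 0" using g'_row by blast
        then have "c ?e = 0"
          using *[of "fbasis l"] by (simp add: fbasis_fvec \<phi>_basis \<psi>_basis)
        then show ?thesis
          using *[of ?e] mem by (simp add: \<phi>_basis)
      qed
    qed (use mem in auto)
    then show ?thesis using q by auto
  next
    case False
    then have col: "g $$ (i, n) = 0" if "i < n" for i using that by blast
    have row: "g $$ (n, j) = 0" if "j < n" for j using False iff that by blast
    have gg': "(\<Sum>l<?N. g $$ (n, l) * g' $$ (l, j)) = (if j = n then 1 else 0)" if "j < ?N" for j
      using mat_mult_index[OF gc g'(1), of n j] that by (auto simp: g')
    have gg'_n: "g $$ (n, n) * g' $$ (n, j) = (if j = n then 1 else 0)" if "j < ?N" for j
      using gg'[OF that] by (simp add: row)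
    then have inv: "g $$ (n, n) * g' $$ (n, n) = 1" by simp
    then have "g $$ (n, n) \<noteq> 0" by auto
    then have g'_row: "g' $$ (n, j) = 0" if "j < n" for j
      using gg'_n[of j] that by simp
    have v_eq: "v = fscale (g $$ (n, n)) ?e"
      using col by (auto simp: v_def fbasis_def fun_eq_iff less_Suc_eq)
    have \<phi>_eq: "\<phi> u = g $$ (n, n) * \<psi> u" for u
      using inv by (simp add: \<phi>_def \<psi>_def g'_row mult.assoc[symmetric])
    have "\<exists>\<beta>. fn.bilinear_form \<beta> \<and> fn.nondegenerate_on ?U \<beta> \<and>
      (\<forall>x\<in>?U. \<forall>y\<in>?U. \<beta> x y = \<beta> y x) \<and> (\<forall>b\<in>{?e}. \<beta> b = \<psi>)"
    proof (rule fn.exists_symmetric_extension[OF _ _ _ subspace_fvec _ fvec_span])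
      show "fn.independent {?e}"
        by (auto simp: fbasis_def fun_eq_iff)
      show "\<forall>b\<in>{?e}. c b = 0" if "\<forall>u\<in>?U. (\<Sum>b\<in>{?e}. c b * \<psi> u) = 0" for c
        using that mem(2) \<psi>_v by auto
    qed (use mem lin in auto)
    then obtain \<beta> where \<beta>: "fn.bilinear_form \<beta>" "fn.nondegenerate_on ?U \<beta>"
      "\<forall>x\<in>?U. \<forall>y\<in>?U. \<beta> x y = \<beta> y x" "\<beta> ?e = \<psi>" by auto
    have "\<beta> v u = \<phi> u" for u
      using \<beta>(1) \<beta>(4) by (auto simp: v_eq \<phi>_eq fn.bilinear_form_def fn.functional_iff)
    then show ?thesis using \<beta> by auto
  qed
  then obtain \<beta> where \<beta>: "fn.bilinear_form \<beta>" "fn.nondegenerate_on ?U \<beta>"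
    and sym: "\<And>x y. x \<in> ?U \<Longrightarrow> y \<in> ?U \<Longrightarrow> \<beta> x y = \<beta> y x"
    and \<beta>_e: "\<And>u. u \<in> ?U \<Longrightarrow> \<beta> ?e u = \<psi> u" and \<beta>_v: "\<And>u. u \<in> ?U \<Longrightarrow> \<beta> v u = \<phi> u"
    by blast
  have functional: "fn.functional (\<beta> x)" for x
    using \<beta>(1) by (auto simp: fn.bilinear_form_def)
  define S where "S = gram_mat ?N \<beta>"
  have S: "S \<in> carrier (general_linear_group ?N)"
    unfolding S_def by (rule gram_mat_GL[OF \<beta>])
  have Sc: "S \<in> carrier_mat ?N ?N" using S by (rule GL_carrier_mat)
  have S_index: "S $$ (i, j) = \<beta> (fbasis i) (fbasis j)" if "i < ?N" "j < ?N" for i j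
    using that by (simp add: S_def gram_mat_index)
  have S_sym: "S\<^sup>T = S"
    by (rule eq_matI) (use Sc in \<open>auto simp: S_index sym fbasis_fvec\<close>)
  define k where "k = S * g"
  have k: "k \<in> carrier (general_linear_group ?N)"
    unfolding k_def by (rule GL_mult_closed[OF S g])
  have kc: "k \<in> carrier_mat ?N ?N" using k by (rule GL_carrier_mat)
  have k_corner: "k \<in> corner_group n"
  proof (rule corner_embedding_image[OF k])
    fix i assume i: "i < n + 1"
    have "k $$ (i, n) = (\<Sum>l<?N. S $$ (i, l) * g $$ (l, n))"
      unfolding k_def using i by (intro mat_mult_index[OF Sc gc]) auto
    also have "\<dots> = (\<Sum>l<?N. v l * \<beta> (fbasis i) (fbasis l))"
      using i by (intro sum.cong) (auto simp: S_index v_def)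
    also have "\<dots> = \<beta> (fbasis i) v"
      by (rule functional_fvec[OF functional mem(2), symmetric])
    also have "\<dots> = \<phi> (fbasis i)"
      using sym[OF fbasis_fvec[OF i] mem(2)] \<beta>_v[OF fbasis_fvec[OF i]] by simp
    finally show "k $$ (i, n) = (if i = n then 1 else 0)"
      by (simp add: \<phi>_basis)
    have "k $$ (n, i) = (\<Sum>l<?N. S $$ (n, l) * g $$ (l, i))"
      unfolding k_def using i by (intro mat_mult_index[OF Sc gc]) auto
    also have "\<dots> = (\<Sum>l<?N. g' $$ (n, l) * g $$ (l, i))"
      by (intro sum.cong) (auto simp: S_index \<beta>_e fbasis_fvec \<psi>_basis)
    finally have "k $$ (n, i) = (\<Sum>l<?N. g' $$ (n, l) * g $$ (l, i))" .
    then show "k $$ (n, i) = (if i = n then 1 else 0)"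
      using \<psi>_col[OF i] by simp
  qed
  obtain k' where k': "k' \<in> carrier_mat ?N ?N" "k * k' = 1\<^sub>m ?N" "k' * k = 1\<^sub>m ?N"
    by (rule GL_inverse[OF k])
  have "k\<^sup>T = g\<^sup>T * S"
    unfolding k_def using Sc gc S_sym by (simp add: transpose_mult[of S ?N ?N g ?N])
  then have "k\<^sup>T * g * k' = g\<^sup>T * (S * g * k')"
    using Sc gc k'(1) by (simp add: assoc_mult_mat[of _ ?N ?N _ ?N _ ?N])
  also have "\<dots> = g\<^sup>T"
    using k'(2) gc by (simp add: k_def)
  finally show ?thesis
    using corner_group_transpose[OF k_corner] corner_group_inverse[OF k_corner k'] by (metis)
qed


text \<open>After division by the corner entry \<open>d\<close>, the last row is that of the
  identity and the last column is \<open>b\<close> above 1 with \<open>b\<close> nonzero. If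
  \<open>P\<close> has first column \<open>b\<close>, then the product \<open>m\<close> of its
  embedding \<open>h\<close> with the transvection has the same last row and column as the scaled
  matrix \<open>f\<close>. Hence the inverse of \<open>m\<close> times \<open>f\<close> lies in the
  corner group.\<close>

lemma transvection_double_coset:
  fixes g :: "'q::field mat"
  assumes g: "g \<in> carrier (general_linear_group (n + 1))"
    and col: "\<exists>i<n. g $$ (i, n) \<noteq> 0" and row: "\<And>j. j < n \<Longrightarrow> g $$ (n, j) = 0"
  shows "\<exists>c. c \<noteq> 0 \<and> (\<exists>h\<in>corner_group n. \<exists>k\<in>corner_group n.
    g = (c \<cdot>\<^sub>m 1\<^sub>m (n + 1)) * (h * addrow_mat (n + 1) 1 0 n * k))"
proof -
  let ?N = "n + 1"
  define t :: "'q mat" where "t = addrow_mat ?N 1 0 n"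
  have "0 < n" using col by auto
  have gc: "g \<in> carrier_mat ?N ?N" using g by (rule GL_carrier_mat)
  obtain g' where g': "g' \<in> carrier_mat ?N ?N" "g * g' = 1\<^sub>m ?N" "g' * g = 1\<^sub>m ?N"
    by (rule GL_inverse[OF g])
  define d where "d = g $$ (n, n)"
  have "d * g' $$ (n, n) = 1"
    using mat_mult_index[OF gc g'(1), of n n] row by (simp add: g' d_def)
  then have "d \<noteq> 0" by auto
  define f where "f = (1 / d) \<cdot>\<^sub>m g"
  have f: "f \<in> carrier (general_linear_group ?N)"
    using g \<open>d \<noteq> 0\<close> by (auto simp: f_def GL_iff)
  have fc: "f \<in> carrier_mat ?N ?N" using f by (rule GL_carrier_mat)
  have f_row: "f $$ (n, j) = (if j = n then 1 else 0)" if "j < ?N" for j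
    using that row gc \<open>d \<noteq> 0\<close> by (auto simp: f_def d_def)
  define b where "b i = (if i < n then f $$ (i, n) else 0)" for i
  obtain i where i: "i < n" "g $$ (i, n) \<noteq> 0" using col by blast
  have "b i \<noteq> 0"
    using i gc \<open>d \<noteq> 0\<close> by (simp add: b_def f_def)
  then have "b \<noteq> 0" by (metis zero_fun_apply)
  moreover have "b \<in> fvec n" by (simp add: fvec_def b_def)
  ultimately obtain P where P: "P \<in> carrier (general_linear_group n)" "\<And>i. i < n \<Longrightarrow> P $$ (i, 0) = b i"
    using exists_symmetric_first_column[OF \<open>0 < n\<close>, of b] by blast
  define h where "h = corner_embedding n P"
  have h: "h \<in> corner_group n" using P(1) by (simp add: h_def)
  have hc: "h \<in> carrier_mat ?N ?N"
    using corner_group_GL[OF h] by (rule GL_carrier_mat)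
  have h_col: "h $$ (i, 0) = (if i < n then b i else 0)" if "i < ?N" for i
    using that P \<open>0 < n\<close> GL_carrier_mat[OF P(1)] by (auto simp: h_def corner_embedding_def)
  have t: "t \<in> carrier (general_linear_group ?N)"
    unfolding t_def using \<open>0 < n\<close> by (intro addrow_mat_GL) auto
  have tc: "t \<in> carrier_mat ?N ?N" using t by (rule GL_carrier_mat)
  have t_index: "t $$ (i, j) = (if i = j then 1 else 0) + (if i = 0 \<and> j = n then 1 else 0)"
    if "i < ?N" "j < ?N" for i j
    using that by (auto simp: t_def addrow_mat_def)
  define m where "m = h * t"
  have m: "m \<in> carrier (general_linear_group ?N)"
    unfolding m_def by (rule GL_mult_closed[OF corner_group_GL[OF h] t])
  have mc: "m \<in> carrier_mat ?N ?N" using m by (rule GL_carrier_mat)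
  obtain m' where m': "m' \<in> carrier (general_linear_group ?N)" "m' \<in> carrier_mat ?N ?N"
    "m * m' = 1\<^sub>m ?N" "m' * m = 1\<^sub>m ?N"
    by (rule GL_inverse[OF m])
  have m_col: "m $$ (i, n) = f $$ (i, n)" if i: "i < ?N" for i
  proof -
    have "m $$ (i, n) = (\<Sum>l<?N. h $$ (i, l) * t $$ (l, n))"
      unfolding m_def using mat_mult_index[OF hc tc i, of n] by simp
    also have "\<dots> = (\<Sum>l<?N. (if l = n then h $$ (i, n) else 0) + (if l = 0 then h $$ (i, 0) else 0))"
      by (intro sum.cong) (auto simp: t_index algebra_simps)
    also have "\<dots> = h $$ (i, n) + h $$ (i, 0)"
      by (simp add: sum.distrib)
    also have "\<dots> = f $$ (i, n)"
      using corner_group_index(1)[OF h i] h_col[OF i] i f_row[of n]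
      by (cases "i = n") (simp_all add: b_def)
    finally show ?thesis .
  qed
  have m_row: "m $$ (n, j) = (if j = n then 1 else 0)" if j: "j < ?N" for j
  proof -
    have "m $$ (n, j) = (\<Sum>l<?N. h $$ (n, l) * t $$ (l, j))"
      unfolding m_def using mat_mult_index[OF hc tc _ j, of n] by simp
    also have "\<dots> = (\<Sum>l<?N. if l = n then t $$ (n, j) else 0)"
      using corner_group_index(2)[OF h] by (intro sum.cong) auto
    finally show ?thesis
      using j \<open>0 < n\<close> by (simp add: t_index)
  qed
  have m'_row: "m' $$ (n, j) = (if j = n then 1 else 0)" if j: "j < ?N" for j
  proof -
    have "(m * m') $$ (n, j) = (\<Sum>l<?N. m $$ (n, l) * m' $$ (l, j))"
      using j by (intro mat_mult_index[OF mc m'(2)]) auto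
    also have "\<dots> = (\<Sum>l<?N. if l = n then m' $$ (n, j) else 0)"
      using m_row by (intro sum.cong) auto
    finally show ?thesis using j by (auto simp: m')
  qed
  define k where "k = m' * f"
  have k: "k \<in> corner_group n"
  proof (rule corner_embedding_image)
    show "k \<in> carrier (general_linear_group (n + 1))"
      unfolding k_def by (rule GL_mult_closed[OF m'(1) f])
    fix i assume i: "i < n + 1"
    have "k $$ (i, n) = (m' * m) $$ (i, n)"
      unfolding k_def using mat_mult_index[OF m'(2) fc i, of n] mat_mult_index[OF m'(2) mc i, of n]
      by (simp add: m_col)
    then show "k $$ (i, n) = (if i = n then 1 else 0)"
      using i by (simp add: m')
    have "k $$ (n, i) = (\<Sum>l<?N. m' $$ (n, l) * f $$ (l, i))"
      unfolding k_def using i by (intro mat_mult_index[OF m'(2) fc]) auto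
    also have "\<dots> = (\<Sum>l<?N. if l = n then f $$ (n, i) else 0)"
      using m'_row by (intro sum.cong) auto
    finally show "k $$ (n, i) = (if i = n then 1 else 0)"
      using f_row[OF i] by simp
  qed
  have "h * t * k = (m * m') * f"
    unfolding k_def m_def[symmetric] using mc m'(2) fc by (simp add: assoc_mult_mat[of _ ?N ?N _ ?N _ ?N])
  then have "h * t * k = f"
    using m'(3) fc by simp
  moreover have "(d \<cdot>\<^sub>m 1\<^sub>m ?N) * f = g"
  proof -
    have "(d \<cdot>\<^sub>m 1\<^sub>m ?N) * f = d \<cdot>\<^sub>m f"
      using mult_smult_assoc_mat[of "1\<^sub>m ?N" ?N ?N f ?N d] fc by simp
    also have "\<dots> = g"
      using gc \<open>d \<noteq> 0\<close> by (auto simp: f_def intro!: eq_matI)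
    finally show ?thesis .
  qed
  ultimately show ?thesis
    using \<open>d \<noteq> 0\<close> h k unfolding t_def by (intro exI[of _ d]) auto
qed

section \<open>The criterion for the general linear group over a finite field\<close>

lemma finite_GL: "finite (carrier (general_linear_group n :: 'q::{field,finite} mat monoid))"
proof -
  have "finite ({..<n} \<times> {..<n} \<rightarrow>\<^sub>E (UNIV :: 'q set))"
    by (intro finite_PiE) auto
  moreover have "A \<in> mat n n ` ({..<n} \<times> {..<n} \<rightarrow>\<^sub>E (UNIV :: 'q set))"
    if "A \<in> carrier (general_linear_group n)" for A
    using GL_carrier_mat[OF that]
    by (intro image_eqI[of _ _ "restrict (\<lambda>ij. A $$ ij) ({..<n} \<times> {..<n})"]) (auto intro!: eq_matI)
  ultimately show ?thesis
    by (meson finite_imageI finite_subset subsetI)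
qed

theorem corollary1p5:
  fixes n :: nat
    and scale :: "'f :: alg_closed_field \<Rightarrow> 'v :: ab_group_add \<Rightarrow> 'v"
    and \<pi> :: "'q :: {field, finite} mat \<Rightarrow> 'v \<Rightarrow> 'v"
  assumes "n \<ge> 1"
    and "CHAR('f) \<noteq> 2"
    and "irreducible_representation (general_linear_group (n + 1)) scale \<pi>"
  defines "W \<equiv> fixed_vectors (corner_embedding n ` carrier (general_linear_group n)) \<pi>"
  shows "(\<exists>B. finite B \<and> W \<subseteq> module.span scale B) \<and> vector_space.dim scale W \<le> 2"
proof -
  let ?N = "n + 1"
  let ?G = "general_linear_group ?N :: 'q mat monoid"
  interpret irreducible_representation ?G scale \<pi> by fact
  interpret finite_irrep ?G scale \<pi>
    by unfold_locales (rule finite_GL)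
  interpret finite_irrep_inv ?G scale \<pi> transpose_mat
  proof unfold_locales
    fix A assume A: "A \<in> carrier ?G"
    then show "A\<^sup>T \<in> carrier ?G" by (rule GL_transpose)
    show "(A\<^sup>T)\<^sup>T = A" by simp
    show "(A \<otimes>\<^bsub>?G\<^esub> B)\<^sup>T = B\<^sup>T \<otimes>\<^bsub>?G\<^esub> A\<^sup>T" if "B \<in> carrier ?G" for B
      using transpose_mult[OF GL_carrier_mat[OF A] GL_carrier_mat[OF that]] by (simp add: GL_mult)
    obtain S where S: "S \<in> carrier ?G" "A\<^sup>T * S = S * A"
      using transpose_conjugate[OF GL_carrier_mat[OF A]] by blast
    have "A\<^sup>T \<otimes>\<^bsub>?G\<^esub> S = S \<otimes>\<^bsub>?G\<^esub> A" using S(2) by (simp add: GL_mult)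
    then have "A\<^sup>T = S \<otimes>\<^bsub>?G\<^esub> A \<otimes>\<^bsub>?G\<^esub> inv\<^bsub>?G\<^esub> S"
      using inv_solve_right[OF GL_transpose[OF A] m_closed[OF S(1) A] S(1)] by simp
    then show "\<exists>s\<in>carrier ?G. A\<^sup>T = s \<otimes>\<^bsub>?G\<^esub> A \<otimes>\<^bsub>?G\<^esub> inv\<^bsub>?G\<^esub> s"
      using S(1) by blast
  qed
  \<comment> \<open>Off the diagonal, the last column of this transvection is nonzero and its last
    row is zero, so \<open>t\<close> represents one of the two exceptional double cosets and its
    transpose the other.\<close>
  define t :: "'q mat" where "t = addrow_mat ?N 1 0 n"
  have t: "t \<in> carrier ?G"
    unfolding t_def using \<open>n \<ge> 1\<close> by (intro addrow_mat_GL) auto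
  define Z :: "'q mat set" where "Z = {c \<cdot>\<^sub>m 1\<^sub>m ?N |c. c \<noteq> 0}"
  have central: "(c \<cdot>\<^sub>m 1\<^sub>m ?N) * A = A * (c \<cdot>\<^sub>m 1\<^sub>m ?N)" if "A \<in> carrier_mat ?N ?N" for c :: 'q and A
    using that mult_smult_assoc_mat[of "1\<^sub>m ?N" ?N ?N A ?N c] mult_smult_distrib[of A ?N ?N "1\<^sub>m ?N" ?N c]
    by simp
  have "dim W \<le> 2"
    unfolding W_def
  proof (rule dim_fixed_vectors_le_2)
    show "corner_group n \<subseteq> carrier ?G" using corner_group_GL by blast
    show "h\<^sup>T \<in> corner_group n" if "h \<in> corner_group n" for h :: "'q mat"
      using that by (rule corner_group_transpose)
    show "Z \<subseteq> carrier ?G" by (auto simp: Z_def GL_iff)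
    show "z \<otimes>\<^bsub>?G\<^esub> g = g \<otimes>\<^bsub>?G\<^esub> z" if "z \<in> Z" "g \<in> carrier ?G" for z g
      using that central by (auto simp: Z_def GL_mult GL_carrier_mat)
    show "t \<in> carrier ?G" by (rule t)
    show "(\<exists>h\<in>corner_group n. \<exists>k\<in>corner_group n. g\<^sup>T = h \<otimes>\<^bsub>?G\<^esub> g \<otimes>\<^bsub>?G\<^esub> k) \<or>
      (\<exists>z\<in>Z. \<exists>h\<in>corner_group n. \<exists>k\<in>corner_group n.
        g = z \<otimes>\<^bsub>?G\<^esub> (h \<otimes>\<^bsub>?G\<^esub> t \<otimes>\<^bsub>?G\<^esub> k) \<or> g = z \<otimes>\<^bsub>?G\<^esub> (h \<otimes>\<^bsub>?G\<^esub> t\<^sup>T \<otimes>\<^bsub>?G\<^esub> k))"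
      if g: "g \<in> carrier ?G" for g
    proof -
      have gc: "g \<in> carrier_mat ?N ?N" using g by (rule GL_carrier_mat)
      consider (iff) "(\<exists>i<n. g $$ (i, n) \<noteq> 0) \<longleftrightarrow> (\<exists>j<n. g $$ (n, j) \<noteq> 0)"
        | (col) "\<exists>i<n. g $$ (i, n) \<noteq> 0" "\<And>j. j < n \<Longrightarrow> g $$ (n, j) = 0"
        | (row) "\<exists>j<n. g $$ (n, j) \<noteq> 0" "\<And>i. i < n \<Longrightarrow> g $$ (i, n) = 0"
        by blast
      then show ?thesis
      proof cases
        case iff
        then show ?thesis
          using transpose_in_double_coset[OF g] by (simp add: GL_mult)
      next
        case col
        then show ?thesis
          using transvection_double_coset[OF g] unfolding GL_mult Z_def t_def by blast
      next
        case row
        \<comment> \<open>This is the previous case for the transpose of \<open>g\<close>.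
          Transposing back reverses the product and replaces \<open>t\<close> by its
          transpose.\<close>
        have "\<exists>i<n. g\<^sup>T $$ (i, n) \<noteq> 0" "\<And>j. j < n \<Longrightarrow> g\<^sup>T $$ (n, j) = 0"
          using row gc by auto
        from transvection_double_coset[OF GL_transpose[OF g] this]
        obtain c h k where c: "c \<noteq> 0" and h: "h \<in> corner_group n" and k: "k \<in> corner_group n"
          and eq: "g\<^sup>T = (c \<cdot>\<^sub>m 1\<^sub>m ?N) * (h * t * k)"
          unfolding t_def by blast
        have carr: "h \<in> carrier_mat ?N ?N" "k \<in> carrier_mat ?N ?N" "t \<in> carrier_mat ?N ?N"
          using GL_carrier_mat[OF corner_group_GL[OF h]] GL_carrier_mat[OF corner_group_GL[OF k]]
            GL_carrier_mat[OF t] by auto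
        have htk: "h * t * k \<in> carrier_mat ?N ?N" using carr by simp
        then have htk_c: "(h * t * k)\<^sup>T \<in> carrier_mat ?N ?N" by simp
        have "(h * t * k)\<^sup>T = k\<^sup>T * (t\<^sup>T * h\<^sup>T)"
          using carr transpose_mult[of "h * t" ?N ?N k ?N] transpose_mult[of h ?N ?N t ?N] by simp
        also have "\<dots> = k\<^sup>T * t\<^sup>T * h\<^sup>T"
          using carr by (simp add: assoc_mult_mat[of _ ?N ?N _ ?N _ ?N])
        finally have htk_T: "(h * t * k)\<^sup>T = k\<^sup>T * t\<^sup>T * h\<^sup>T" .
        have "g = (g\<^sup>T)\<^sup>T" by simp
        also have "g\<^sup>T = c \<cdot>\<^sub>m (h * t * k)"
          unfolding eq
          using mult_smult_assoc_mat[OF one_carrier_mat htk] left_mult_one_mat[OF htk] by simp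
        also have "(c \<cdot>\<^sub>m (h * t * k))\<^sup>T = c \<cdot>\<^sub>m (h * t * k)\<^sup>T"
          by (rule eq_matI) auto
        also have "\<dots> = (c \<cdot>\<^sub>m 1\<^sub>m ?N) * (h * t * k)\<^sup>T"
          using mult_smult_assoc_mat[OF one_carrier_mat htk_c] left_mult_one_mat[OF htk_c] by simp
        finally have "g = (c \<cdot>\<^sub>m 1\<^sub>m ?N) * (k\<^sup>T * t\<^sup>T * h\<^sup>T)"
          by (simp only: htk_T)
        then show ?thesis
          using c corner_group_transpose[OF h] corner_group_transpose[OF k]
          unfolding GL_mult Z_def by blast
      qed
    qed
    show "(2 :: 'f) \<noteq> 0"
    proof
      assume "(2 :: 'f) = 0"
      then have "of_nat 2 = (0 :: 'f)" by simp
      then have "CHAR('f) dvd 2" by (simp only: of_nat_eq_0_iff_char_dvd)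
      \<comment> \<open>A characteristic dividing 2 is 1 or 2, and a field never has characteristic
        1.\<close>
      then have "CHAR('f) \<le> 2" "CHAR('f) \<noteq> 0" by (auto dest: dvd_imp_le intro!: Nat.gr0I)
      then show False
        using assms(2) CHAR_not_1'[where 'a = 'f] by linarith
    qed
  qed
  \<comment> \<open>\<open>dim\<close> takes the value 0 on infinite-dimensional subspaces, so the
    bound is meaningful only together with a finite spanning set.\<close>
  moreover have "\<exists>B. finite B \<and> W \<subseteq> span B"
    using finite_Basis span_Basis by auto
  ultimately show ?thesis by blast
qed

end
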